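(* Let $N\ge2$ and $\Omega=B_1(0)\subset\mathbb{R}^N$. There exist nonnegative functions $a$ and $f$ in $L^{N/2}(\Omega)$ such that there exists $Q>0$ with $|f(x)|\le Q\,a(x)$ for a.e. $x\in\Omega$, and such that the problem $$u\in W_0^{1,2}(\Omega)\cap L^\infty(\Omega):\quad\int_\Omega\nabla u\cdot\nabla\varphi+\int_\Omega a(x)\,u\,\varphi=\int_\Omega f(x)\,\varphi,\qquad\forall\,\varphi\in W_0^{1,2}(\Omega)\cap L^\infty(\Omega),$$ has a continuous solution which is not Hölder continuous.
   Context: $B_1(0)$ is the open unit ball of $\mathbb{R}^N$ centered at the origin. "Not Hölder continuous" means that $u$ is not Hölder continuous in $\Omega$ with exponent $\gamma$ for any $\gamma\in(0,1]$. *)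

theory Defs
  imports "HOL-Analysis.Analysis"
begin

text \<open>Elements of the function spaces below are represented by total functions, of which only
  the values almost everywhere in the domain matter. Domains are open sets.\<close>

definition Lp :: "real \<Rightarrow> 'a::euclidean_space set \<Rightarrow> ('a \<Rightarrow> 'b::euclidean_space) set" where
  "Lp p \<Omega> = {f. f \<in> borel_measurable (lebesgue_on \<Omega>) \<and>
                integrable (lebesgue_on \<Omega>) (\<lambda>x. norm (f x) powr p)}"

definition Linf :: "'a::euclidean_space set \<Rightarrow> ('a \<Rightarrow> real) set" where
  "Linf \<Omega> = {f. f \<in> borel_measurable (lebesgue_on \<Omega>) \<and>
                (\<exists>C. AE x in lebesgue_on \<Omega>. \<bar>f x\<bar> \<le> C)}"

definition L1_loc :: "'a::euclidean_space set \<Rightarrow> ('a \<Rightarrow> 'b::euclidean_space) set" where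
  "L1_loc \<Omega> = {f. \<forall>K. compact K \<and> K \<subseteq> \<Omega> \<longrightarrow> set_integrable lebesgue K f}"

text \<open>A function is of class \<open>C\<^sup>k\<^sup>+\<^sup>1\<close> on the whole space iff it is differentiable and all its first
  partial derivatives are of class \<open>C\<^sup>k\<close>.\<close>

primrec Ck :: "nat \<Rightarrow> ('a::euclidean_space \<Rightarrow> real) \<Rightarrow> bool" where
  "Ck 0 f \<longleftrightarrow> continuous_on UNIV f"
| "Ck (Suc k) f \<longleftrightarrow> (\<forall>x. f differentiable (at x)) \<and>
     (\<forall>i\<in>Basis. Ck k (\<lambda>x. frechet_derivative f (at x) i))"

definition test_functions :: "'a::euclidean_space set \<Rightarrow> ('a \<Rightarrow> real) set" where
  "test_functions \<Omega> = {\<phi>. (\<forall>k. Ck k \<phi>) \<and> compact (closure {x. \<phi> x \<noteq> 0}) \<and>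
                          closure {x. \<phi> x \<noteq> 0} \<subseteq> \<Omega>}"

definition has_weak_grad ::
    "'a::euclidean_space set \<Rightarrow> ('a \<Rightarrow> real) \<Rightarrow> ('a \<Rightarrow> 'a) \<Rightarrow> bool" where
  "has_weak_grad \<Omega> u g \<longleftrightarrow> u \<in> L1_loc \<Omega> \<and> g \<in> L1_loc \<Omega> \<and>
     (\<forall>\<phi>\<in>test_functions \<Omega>. \<forall>i\<in>Basis.
        (LINT x|lebesgue_on \<Omega>. u x * frechet_derivative \<phi> (at x) i) =
        - (LINT x|lebesgue_on \<Omega>. (g x \<bullet> i) * \<phi> x))"

text \<open>The weak gradient is unique only up to null sets; an arbitrary version is chosen.
  It is meaningful only for functions that have a weak gradient.\<close>

definition weak_grad :: "'a::euclidean_space set \<Rightarrow> ('a \<Rightarrow> real) \<Rightarrow> 'a \<Rightarrow> 'a" where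
  "weak_grad \<Omega> u = (SOME g. has_weak_grad \<Omega> u g)"

definition W12 :: "'a::euclidean_space set \<Rightarrow> ('a \<Rightarrow> real) set" where
  "W12 \<Omega> = {u. u \<in> Lp 2 \<Omega> \<and> (\<exists>g. has_weak_grad \<Omega> u g) \<and> weak_grad \<Omega> u \<in> Lp 2 \<Omega>}"

definition W12_norm :: "'a::euclidean_space set \<Rightarrow> ('a \<Rightarrow> real) \<Rightarrow> real" where
  "W12_norm \<Omega> u = sqrt ((LINT x|lebesgue_on \<Omega>. (u x)\<^sup>2) +
                         (LINT x|lebesgue_on \<Omega>. (norm (weak_grad \<Omega> u x))\<^sup>2))"

text \<open>The closure of the test functions in \<open>W\<^sup>1\<^sup>,\<^sup>2\<close>.\<close>

definition W12_0 :: "'a::euclidean_space set \<Rightarrow> ('a \<Rightarrow> real) set" where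
  "W12_0 \<Omega> = {u \<in> W12 \<Omega>. \<exists>\<phi>. (\<forall>k. \<phi> k \<in> test_functions \<Omega>) \<and>
                (\<lambda>k::nat. W12_norm \<Omega> (\<lambda>x. \<phi> k x - u x)) \<longlonglongrightarrow> 0}"

text \<open>For a bounded domain and \<open>a\<close>, \<open>f\<close> in \<open>L\<^sup>1\<close>, all three integrands are integrable.\<close>

definition is_solution ::
    "'a::euclidean_space set \<Rightarrow> ('a \<Rightarrow> real) \<Rightarrow> ('a \<Rightarrow> real) \<Rightarrow> ('a \<Rightarrow> real) \<Rightarrow> bool" where
  "is_solution \<Omega> a f u \<longleftrightarrow> u \<in> W12_0 \<Omega> \<inter> Linf \<Omega> \<and>
     (\<forall>\<phi>\<in>W12_0 \<Omega> \<inter> Linf \<Omega>.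
        (LINT x|lebesgue_on \<Omega>. weak_grad \<Omega> u x \<bullet> weak_grad \<Omega> \<phi> x) +
        (LINT x|lebesgue_on \<Omega>. a x * u x * \<phi> x) =
        (LINT x|lebesgue_on \<Omega>. f x * \<phi> x))"

definition holder_continuous_on :: "real \<Rightarrow> 'a::metric_space set \<Rightarrow> ('a \<Rightarrow> real) \<Rightarrow> bool" where
  "holder_continuous_on \<gamma> \<Omega> u \<longleftrightarrow>
     (\<exists>C. \<forall>x\<in>\<Omega>. \<forall>y\<in>\<Omega>. \<bar>u x - u y\<bar> \<le> C * dist x y powr \<gamma>)"

end

theory Submission
  imports Defs
begin

text \<open>The solution is \<open>u = 1/4 - 1/(4 - ln |x|\<^sup>2)\<close>, whose modulus of continuity at the origin is
  logarithmic. It is superharmonic: \<open>h = - \<Delta>u\<close> is nonnegative and at most a multiple of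
  \<open>1/(|x|\<^sup>2 (4 - ln |x|\<^sup>2)\<^sup>2)\<close>, which is in \<open>L\<^sup>N\<^sup>/\<^sup>2\<close> of the unit ball precisely because \<open>N \<ge> 2\<close>.
  Taking \<open>a = h\<close> and \<open>f = h (1 + u) \<le> 2 a\<close>, the equation reduces to \<open>- \<Delta>u = h\<close>.

  The Sobolev embedding is avoided: replacing \<open>|x|\<^sup>2\<close> by \<open>|x|\<^sup>2 + d\<close> gives bounded data, for which
  integration by parts extends from test functions to \<open>W\<^sub>0\<^sup>1\<^sup>,\<^sup>2\<close>, and letting \<open>d\<close> tend to \<open>0\<close> with
  a bounded test function only needs dominated convergence.\<close>

subsection \<open>Functions of class \<open>C\<^sup>k\<close> on open sets\<close>

primrec Ck_on :: "nat \<Rightarrow> 'a::euclidean_space set \<Rightarrow> ('a \<Rightarrow> real) \<Rightarrow> bool" where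
  "Ck_on 0 S f \<longleftrightarrow> continuous_on S f"
| "Ck_on (Suc k) S f \<longleftrightarrow> (\<forall>x\<in>S. f differentiable (at x)) \<and>
     (\<forall>i\<in>Basis. Ck_on k S (\<lambda>x. frechet_derivative f (at x) i))"

lemma Ck_on_UNIV: "Ck_on k UNIV f \<longleftrightarrow> Ck k f"
  by (induction k arbitrary: f) auto

lemma Ck_on_cong:
  assumes "open S" "\<And>x. x \<in> S \<Longrightarrow> f x = g x" "Ck_on k S f"
  shows "Ck_on k S g"
  using assms(2,3)
proof (induction k arbitrary: f g)
  case 0
  then show ?case by (simp cong: continuous_on_cong)
next
  case (Suc k)
  have d: "(g has_derivative frechet_derivative f (at x)) (at x)" if "x \<in> S" for x
    using Suc.prems that frechet_derivative_works
    by (metis Ck_on.simps(2) assms(1) has_derivative_transform_within_open)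
  then have "frechet_derivative f (at x) = frechet_derivative g (at x)" if "x \<in> S" for x
    using that frechet_derivative_at by blast
  then have "Ck_on k S (\<lambda>x. frechet_derivative g (at x) i)" if "i \<in> Basis" for i
    using Suc.IH[of "\<lambda>x. frechet_derivative f (at x) i" "\<lambda>x. frechet_derivative g (at x) i"]
      Suc.prems that by simp
  then show ?case using d by (auto simp: differentiable_def)
qed

lemma Ck_on_SucI:
  assumes "open S" "\<And>x. x \<in> S \<Longrightarrow> (f has_derivative f' x) (at x)"
    "\<And>i. i \<in> Basis \<Longrightarrow> Ck_on k S (\<lambda>x. f' x i)"
  shows "Ck_on (Suc k) S f"
proof -
  have "f' x = frechet_derivative f (at x)" if "x \<in> S" for x
    using assms(2)[OF that] frechet_derivative_at by blast
  then have "Ck_on k S (\<lambda>x. frechet_derivative f (at x) i)" if "i \<in> Basis" for i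
    using assms(3)[OF that] Ck_on_cong[OF assms(1), of "\<lambda>x. f' x i"] by simp
  then show ?thesis using assms(2) by (auto simp: differentiable_def)
qed

lemma Ck_on_SucD:
  assumes "Ck_on (Suc k) S f"
  shows "x \<in> S \<Longrightarrow> (f has_derivative frechet_derivative f (at x)) (at x)"
    and "i \<in> Basis \<Longrightarrow> Ck_on k S (\<lambda>x. frechet_derivative f (at x) i)"
  using assms frechet_derivative_works by auto

lemma Ck_on_Suc_imp: "Ck_on (Suc k) S f \<Longrightarrow> Ck_on k S f"
proof (induction k arbitrary: f)
  case 0
  then show ?case
    by (auto intro!: continuous_at_imp_continuous_on differentiable_imp_continuous_within)
next
  case (Suc k)
  then show ?case by (metis Ck_on.simps(2))
qed

lemma Ck_on_Un:
  assumes "open S" "open T"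
  shows "Ck_on k S f \<Longrightarrow> Ck_on k T f \<Longrightarrow> Ck_on k (S \<union> T) f"
  by (induction k arbitrary: f) (auto intro: continuous_on_open_Un assms)

lemma Ck_on_const: "open S \<Longrightarrow> Ck_on k S (\<lambda>x. c)"
proof (induction k arbitrary: c)
  case (Suc k)
  show ?case by (rule Ck_on_SucI[OF Suc.prems has_derivative_const]) (simp add: Suc)
qed simp

lemma Ck_on_inner: "open S \<Longrightarrow> Ck_on k S (\<lambda>x. x \<bullet> c)"
proof (cases k)
  case (Suc n)
  assume "open S"
  then show ?thesis unfolding Suc
    by (intro Ck_on_SucI[where f' = "\<lambda>x h. h \<bullet> c"] Ck_on_const)
       (auto intro!: derivative_eq_intros)
qed (simp add: continuous_intros)

lemma Ck_on_ident: "open S \<Longrightarrow> Ck_on k S (\<lambda>x::real. x)"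
  using Ck_on_inner[of S k 1] by simp

lemma Ck_on_add:
  "open S \<Longrightarrow> Ck_on k S f \<Longrightarrow> Ck_on k S g \<Longrightarrow> Ck_on k S (\<lambda>x. f x + g x)"
proof (induction k arbitrary: f g)
  case (Suc k)
  show ?case
  proof (rule Ck_on_SucI[OF Suc.prems(1) has_derivative_add])
    show "Ck_on k S (\<lambda>x. frechet_derivative f (at x) i + frechet_derivative g (at x) i)"
      if "i \<in> Basis" for i
      by (intro Suc.IH Suc.prems(1) Ck_on_SucD(2)[OF Suc.prems(2) that]
          Ck_on_SucD(2)[OF Suc.prems(3) that])
  qed (use Suc.prems Ck_on_SucD(1) in blast)+
qed (simp add: continuous_on_add)

lemma Ck_on_mult:
  "open S \<Longrightarrow> Ck_on k S f \<Longrightarrow> Ck_on k S g \<Longrightarrow> Ck_on k S (\<lambda>x. f x * g x)"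
proof (induction k arbitrary: f g)
  case (Suc k)
  show ?case
  proof (rule Ck_on_SucI[OF Suc.prems(1) has_derivative_mult])
    show "Ck_on k S (\<lambda>x. f x * frechet_derivative g (at x) i + frechet_derivative f (at x) i * g x)"
      if "i \<in> Basis" for i
      by (intro Ck_on_add Suc.IH Suc.prems(1) Ck_on_Suc_imp[OF Suc.prems(2)]
          Ck_on_Suc_imp[OF Suc.prems(3)] Ck_on_SucD(2)[OF Suc.prems(2) that]
          Ck_on_SucD(2)[OF Suc.prems(3) that])
  qed (use Suc.prems Ck_on_SucD(1) in blast)+
qed (simp add: continuous_on_mult)

lemma Ck_on_cmult: "open S \<Longrightarrow> Ck_on k S f \<Longrightarrow> Ck_on k S (\<lambda>x. c * f x)"
  by (intro Ck_on_mult Ck_on_const)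

lemma Ck_on_diff:
  "open S \<Longrightarrow> Ck_on k S f \<Longrightarrow> Ck_on k S g \<Longrightarrow> Ck_on k S (\<lambda>x. f x - g x)"
  using Ck_on_add[of S k f "\<lambda>x. (-1) * g x"] Ck_on_cmult[of S k g "-1"] by simp

lemma Ck_on_sum:
  "open S \<Longrightarrow> (\<And>i. i \<in> I \<Longrightarrow> Ck_on k S (f i)) \<Longrightarrow> Ck_on k S (\<lambda>x. \<Sum>i\<in>I. f i x)"
  by (induction I rule: infinite_finite_induct) (auto intro: Ck_on_const Ck_on_add)

lemma Ck_on_prod:
  "open S \<Longrightarrow> (\<And>i. i \<in> I \<Longrightarrow> Ck_on k S (f i)) \<Longrightarrow> Ck_on k S (\<lambda>x. \<Prod>i\<in>I. f i x)"
  by (induction I rule: infinite_finite_induct) (auto intro: Ck_on_const Ck_on_mult)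

lemma Ck_on_inner_self: "open S \<Longrightarrow> Ck_on k S (\<lambda>x. x \<bullet> x)"
  by (subst euclidean_inner) (intro Ck_on_sum Ck_on_mult Ck_on_inner)

lemma Ck_on_compose:
  fixes f :: "'a::euclidean_space \<Rightarrow> real" and g :: "real \<Rightarrow> real"
  assumes "open S" "f ` S \<subseteq> T"
  shows "Ck_on k S f \<Longrightarrow> Ck_on k T g \<Longrightarrow> Ck_on k S (\<lambda>x. g (f x))"
proof (induction k arbitrary: g)
  case 0
  then show ?case using continuous_on_compose2[of T g S f] assms(2) by simp
next
  case (Suc k)
  let ?g = "\<lambda>y. frechet_derivative g (at y) 1"
  have *: "frechet_derivative g (at y) z = z * ?g y" if "y \<in> T" for y z
    using has_derivative_linear[OF Ck_on_SucD(1)[OF Suc.prems(2) that]]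
      linear_scale[of "frechet_derivative g (at y)" z 1] by simp
  have d: "((\<lambda>x. g (f x)) has_derivative (\<lambda>h. frechet_derivative f (at x) h * ?g (f x))) (at x)"
    if "x \<in> S" for x
  proof -
    have "f x \<in> T" using that assms by auto
    moreover have "frechet_derivative g (at (f x)) = (\<lambda>h. h * ?g (f x))"
      using *[OF \<open>f x \<in> T\<close>] by (rule ext)
    ultimately have "(g has_derivative (\<lambda>h. h * ?g (f x))) (at (f x))"
      using Ck_on_SucD(1)[OF Suc.prems(2), of "f x"] by simp
    then show ?thesis
      by (rule has_derivative_compose[OF Ck_on_SucD(1)[OF Suc.prems(1) that]])
  qed
  show ?case
  proof (rule Ck_on_SucI[OF assms(1) d])
    fix i :: 'a assume i: "i \<in> Basis"
    have "Ck_on k T ?g" using Ck_on_SucD(2)[OF Suc.prems(2), of 1] by simp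
    then have "Ck_on k S (\<lambda>x. ?g (f x))"
      by (rule Suc.IH[OF Ck_on_Suc_imp[OF Suc.prems(1)]])
    then show "Ck_on k S (\<lambda>x. frechet_derivative f (at x) i * ?g (f x))"
      by (rule Ck_on_mult[OF assms(1) Ck_on_SucD(2)[OF Suc.prems(1) i]])
  qed
qed

lemma Ck_on_real_SucI:
  assumes "open S" "\<And>x. x \<in> S \<Longrightarrow> (f has_real_derivative f' x) (at x)" "Ck_on k S f'"
  shows "Ck_on (Suc k) S f"
  by (rule Ck_on_SucI[where f' = "\<lambda>x h. f' x * h"]) (use assms in \<open>auto simp: has_field_derivative_def\<close>)

lemma Ck_on_inverse: "Ck_on k {0<..} (inverse :: real \<Rightarrow> real)"
proof (induction k)
  case (Suc k)
  show ?case
    by (rule Ck_on_real_SucI[where f' = "\<lambda>x. (-1) * (inverse x * inverse x)"])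
       (intro Suc Ck_on_cmult Ck_on_mult open_greaterThan | force intro!: derivative_eq_intros)+
qed (auto intro!: continuous_intros)

lemma Ck_on_ln: "Ck_on k {0<..} (ln :: real \<Rightarrow> real)"
proof (cases k)
  case (Suc n)
  show ?thesis unfolding Suc
    by (rule Ck_on_real_SucI[where f' = inverse])
       (auto intro!: derivative_eq_intros Ck_on_inverse simp: field_simps)
qed (auto intro!: continuous_intros)

text \<open>The polynomial factor makes this family closed under differentiation.\<close>

definition exp_cutoff :: "real poly \<Rightarrow> real \<Rightarrow> real" where
  "exp_cutoff p t = (if t > 0 then poly p (1 / t) * exp (- (1 / t)) else 0)"

lemma exp_cutoff_lim:
  fixes p :: "real poly"
  shows "((\<lambda>t. poly p (1 / t) * exp (- (1 / t))) \<longlongrightarrow> 0) (at_right 0)"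
proof -
  have "((\<lambda>z. poly p z * exp (- z)) \<longlongrightarrow> 0) at_top"
  proof -
    have "((\<lambda>z::real. z ^ i * exp (- z)) \<longlongrightarrow> 0) at_top" for i
      using tendsto_power_div_exp_0[of i] by (simp add: exp_minus field_simps)
    note * = this
    have "((\<lambda>z. \<Sum>i\<le>degree p. coeff p i * (z ^ i * exp (- z))) \<longlongrightarrow>
        (\<Sum>i\<le>degree p. coeff p i * 0)) at_top"
      by (intro tendsto_sum tendsto_mult_left *)
    then show ?thesis by (simp add: poly_altdef sum_distrib_right mult.assoc)
  qed
  moreover have "filterlim (\<lambda>t::real. 1 / t) at_top (at_right 0)"
    using filterlim_inverse_at_top_right by (simp add: inverse_eq_divide)
  ultimately show ?thesis by (rule filterlim_compose)
qed

lemma has_derivative_exp_cutoff: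
  "(exp_cutoff p has_real_derivative exp_cutoff ([:0,0,1:] * (p - pderiv p)) t) (at t)"
proof -
  consider "t > 0" | "t < 0" | "t = 0" by linarith
  then show ?thesis
  proof cases
    case 1
    have "((\<lambda>t. poly p (1 / t) * exp (- (1 / t))) has_real_derivative
        exp_cutoff ([:0,0,1:] * (p - pderiv p)) t) (at t)"
      using 1 by (auto intro!: derivative_eq_intros DERIV_chain2[OF poly_DERIV]
          simp: exp_cutoff_def field_simps power2_eq_square)
    then show ?thesis
      by (rule has_field_derivative_transform_within_open[where S = "{0<..}"])
         (use 1 in \<open>auto simp: exp_cutoff_def\<close>)
  next
    case 2
    have "((\<lambda>t. 0) has_real_derivative exp_cutoff ([:0,0,1:] * (p - pderiv p)) t) (at t)"
      using 2 by (simp add: exp_cutoff_def)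
    then show ?thesis
      by (rule has_field_derivative_transform_within_open[where S = "{..<0}"])
         (use 2 in \<open>auto simp: exp_cutoff_def\<close>)
  next
    case 3
    have "((\<lambda>h. exp_cutoff p h / h) \<longlongrightarrow> 0) (at_right 0)"
    proof (rule Lim_transform_eventually)
      show "((\<lambda>t. poly (pCons 0 p) (1 / t) * exp (- (1 / t))) \<longlongrightarrow> 0) (at_right 0)"
        by (rule exp_cutoff_lim)
      show "\<forall>\<^sub>F t in at_right 0. poly (pCons 0 p) (1 / t) * exp (- (1 / t)) = exp_cutoff p t / t"
        by (simp add: eventually_at_filter exp_cutoff_def)
    qed
    moreover have "((\<lambda>h. exp_cutoff p h / h) \<longlongrightarrow> 0) (at_left 0)"
      by (rule Lim_transform_eventually[OF tendsto_const])
         (simp add: eventually_at_filter exp_cutoff_def)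
    ultimately show ?thesis
      unfolding 3 DERIV_def by (simp add: exp_cutoff_def filterlim_at_split)
  qed
qed

lemma Ck_on_exp_cutoff: "Ck_on k UNIV (exp_cutoff p)"
proof (induction k arbitrary: p)
  case 0
  show ?case
    by (auto intro!: continuous_at_imp_continuous_on DERIV_isCont[OF has_derivative_exp_cutoff])
next
  case (Suc k)
  show ?case
    by (rule Ck_on_real_SucI[OF open_UNIV has_derivative_exp_cutoff Suc])
qed

subsection \<open>Integration by parts and the fundamental lemma\<close>

text \<open>By translation invariance the integral of every difference quotient of \<open>w\<close> vanishes.\<close>

lemma integral_compactly_supported_derivative:
  fixes w :: "'a::euclidean_space \<Rightarrow> real"
  assumes d: "\<And>x. (w has_derivative w' x) (at x)"
    and cont: "continuous_on UNIV (\<lambda>x. w' x i)"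
    and K: "compact K" "\<And>x. x \<notin> K \<Longrightarrow> w x = 0"
    and i: "i \<in> Basis"
  shows "(LINT x|lborel. w' x i) = 0"
proof -
  have cw: "continuous_on UNIV w"
    using d has_derivative_continuous by (blast intro: continuous_at_imp_continuous_on)
  have w'0: "w' x i = 0" if "x \<notin> K" for x
  proof -
    have "(w has_derivative (\<lambda>h. 0)) (at x)"
      by (rule has_derivative_transform_within_open[OF has_derivative_const, where s = "- K"])
         (use that K compact_imp_closed in \<open>auto simp: open_Compl\<close>)
    then show ?thesis using has_derivative_unique[OF d[of x]] by metis
  qed
  have compact_int: "integrable lborel f" if "continuous_on UNIV f" "\<And>x. x \<notin> K \<Longrightarrow> f x = 0"
    for f :: "'a \<Rightarrow> real"
  proof -
    have "integrable lborel (\<lambda>x. indicator K x *\<^sub>R f x)"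
      using that by (intro borel_integrable_compact K) (auto intro: continuous_on_subset)
    moreover have "(\<lambda>x. indicator K x *\<^sub>R f x) = f"
      using that(2) by (intro ext) (auto simp: indicator_def)
    ultimately show ?thesis by simp
  qed
  have iw: "integrable lborel w" by (rule compact_int[OF cw K(2)])
  have mw: "w \<in> borel_measurable borel" using cw by (rule borel_measurable_continuous_onI)
  have mw': "(\<lambda>x. w' x i) \<in> borel_measurable borel" using cont by (rule borel_measurable_continuous_onI)
  have "bounded ((\<lambda>x. w' x i) ` K)"
    using K cont by (intro compact_imp_bounded compact_continuous_image) (auto intro: continuous_on_subset)
  then obtain M where M: "M > 0" "\<And>x. x \<in> K \<Longrightarrow> \<bar>w' x i\<bar> \<le> M"
    by (auto simp: bounded_pos)
  have M': "\<bar>w' x i\<bar> \<le> M" for x using M w'0[of x] by (cases "x \<in> K") auto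
  obtain R where R: "\<And>x. x \<in> K \<Longrightarrow> norm x \<le> R"
    using compact_imp_bounded[OF K(1)] by (auto simp: bounded_pos)
  define t where "t = (\<lambda>n. inverse (real (Suc n)))"
  have t: "t n > 0" "t n \<le> 1" for n by (auto simp: t_def field_simps)
  define s where "s = (\<lambda>n x. (w (t n *\<^sub>R i + x) - w x) / t n)"
  have line: "((\<lambda>\<tau>. w (\<tau> *\<^sub>R i + x)) has_real_derivative w' (\<tau> *\<^sub>R i + x) i) (at \<tau>)" for x \<tau>
  proof -
    have "((\<lambda>\<tau>. w (\<tau> *\<^sub>R i + x)) has_derivative (\<lambda>h. w' (\<tau> *\<^sub>R i + x) (h *\<^sub>R i))) (at \<tau>)"
      by (rule has_derivative_compose[OF _ d]) (auto intro!: derivative_eq_intros)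
    then show ?thesis
      using linear_scale[OF has_derivative_linear[OF d]]
      by (simp add: has_field_derivative_def mult.commute[of _ "w' (\<tau> *\<^sub>R i + x) i"])
  qed
  have int_s: "(LINT x|lborel. s n x) = 0" for n
  proof -
    have "integrable (distr lborel borel ((+) (t n *\<^sub>R i))) w"
      unfolding lborel_distr_plus by (rule iw)
    then have i1: "integrable lborel (\<lambda>x. w (t n *\<^sub>R i + x))"
      by (subst (asm) integrable_distr_eq) (use mw in auto)
    have "(LINT x|lborel. w (t n *\<^sub>R i + x)) = (LINT x|distr lborel borel ((+) (t n *\<^sub>R i)). w x)"
      by (subst integral_distr) (use mw in auto)
    then have "(LINT x|lborel. w (t n *\<^sub>R i + x)) = (LINT x|lborel. w x)"
      unfolding lborel_distr_plus .
    then show ?thesis using i1 iw by (simp add: s_def)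
  qed
  have "(\<lambda>n. LINT x|lborel. s n x) \<longlonglongrightarrow> (LINT x|lborel. w' x i)"
  proof (rule integral_dominated_convergence)
    show "(\<lambda>x. w' x i) \<in> borel_measurable lborel" using mw' by simp
    show "s n \<in> borel_measurable lborel" for n unfolding s_def using mw by measurable
    show "integrable lborel (\<lambda>x. indicator (cball 0 (R + 1)) x *\<^sub>R M)"
      by (intro borel_integrable_compact) auto
    show "AE x in lborel. (\<lambda>n. s n x) \<longlonglongrightarrow> w' x i"
    proof (rule AE_I2)
      fix x
      have "((\<lambda>h. (w (h *\<^sub>R i + x) - w x) / h) \<longlongrightarrow> w' x i) (at 0)"
        using line[of x 0] by (simp add: DERIV_def)
      moreover have "filterlim t (at 0) sequentially"
        unfolding filterlim_at t_def using LIMSEQ_inverse_real_of_nat by simp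
      ultimately show "(\<lambda>n. s n x) \<longlonglongrightarrow> w' x i"
        unfolding s_def by (rule filterlim_compose)
    qed
    show "AE x in lborel. norm (s n x) \<le> indicator (cball 0 (R + 1)) x *\<^sub>R M" for n
    proof (rule AE_I2)
      fix x
      show "norm (s n x) \<le> indicator (cball 0 (R + 1)) x *\<^sub>R M"
      proof (cases "x \<in> cball 0 (R + 1)")
        case True
        obtain z where "w (t n *\<^sub>R i + x) - w (0 *\<^sub>R i + x) = (t n - 0) * w' (z *\<^sub>R i + x) i"
          using MVT2[OF t(1)[of n] line] by metis
        then have "s n x = w' (z *\<^sub>R i + x) i" using t(1)[of n] by (simp add: s_def)
        then show ?thesis using M' True by simp
      next
        case False
        then have "norm x > R + 1" by simp
        moreover have "norm x \<le> norm (t n *\<^sub>R i + x) + norm (t n *\<^sub>R i)"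
          by (metis add_diff_cancel_left' norm_triangle_ineq4 add.commute)
        moreover have "norm (t n *\<^sub>R i) \<le> 1" using i t[of n] by simp
        ultimately have "t n *\<^sub>R i + x \<notin> K" "x \<notin> K"
          using R[of x] R[of "t n *\<^sub>R i + x"] by auto
        then show ?thesis using K(2) M by (simp add: s_def)
      qed
    qed
  qed
  then show ?thesis using int_s LIMSEQ_unique[OF tendsto_const] by force
qed

lemma lebesgue_on_compact_support:
  fixes g :: "'a::euclidean_space \<Rightarrow> real"
  assumes "open \<Omega>" "compact K" "K \<subseteq> \<Omega>" "continuous_on K g" "\<And>x. x \<in> \<Omega> - K \<Longrightarrow> g x = 0"
  shows "integrable (lebesgue_on \<Omega>) g"
    and "(LINT x|lebesgue_on \<Omega>. g x) = (LINT x|lborel. indicator K x *\<^sub>R g x)"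
    and "integrable lborel (\<lambda>x. indicator K x *\<^sub>R g x)"
proof -
  have eq: "(\<lambda>x. indicator \<Omega> x *\<^sub>R g x) = (\<lambda>x. indicator K x *\<^sub>R g x)"
    using assms(3,5) by (intro ext) (auto simp: indicator_def)
  show i: "integrable lborel (\<lambda>x. indicator K x *\<^sub>R g x)"
    by (rule borel_integrable_compact) fact+
  then have m: "(\<lambda>x. indicator K x *\<^sub>R g x) \<in> borel_measurable lborel" by measurable
  show "integrable (lebesgue_on \<Omega>) g"
    using integrable_completion[OF m] i assms(1) by (simp add: integrable_restrict_space eq del: real_scaleR_def)
  show "(LINT x|lebesgue_on \<Omega>. g x) = (LINT x|lborel. indicator K x *\<^sub>R g x)"
    using integral_completion[OF m] assms(1) by (simp add: integral_restrict_space eq del: real_scaleR_def)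
qed

lemma test_functionD:
  fixes \<phi> :: "'a::euclidean_space \<Rightarrow> real"
  assumes "\<phi> \<in> test_functions \<Omega>"
  obtains K where "compact K" "K \<subseteq> \<Omega>" "\<And>x. x \<notin> K \<Longrightarrow> \<phi> x = 0"
    "\<And>x i. x \<notin> K \<Longrightarrow> frechet_derivative \<phi> (at x) i = 0"
proof -
  define K where "K = closure {x. \<phi> x \<noteq> 0}"
  have z: "\<phi> x = 0" if "x \<notin> K" for x
    using that closure_subset[of "{x. \<phi> x \<noteq> 0}"] by (auto simp: K_def)
  have d: "frechet_derivative \<phi> (at x) = (\<lambda>h. 0)" if "x \<notin> K" for x
  proof -
    have "(\<phi> has_derivative (\<lambda>h. 0)) (at x)"
    proof (rule has_derivative_transform_within_open[OF has_derivative_const])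
      show "open (- K)" by (simp add: K_def open_Compl)
    qed (use that z in simp_all)
    then show ?thesis by (rule frechet_derivative_at[symmetric])
  qed
  show ?thesis
  proof (rule that[of K])
    show "compact K" "K \<subseteq> \<Omega>" using assms by (simp_all add: test_functions_def K_def)
  qed (simp_all add: z d)
qed

lemma test_function_derivative:
  assumes "\<phi> \<in> test_functions \<Omega>"
  shows "(\<phi> has_derivative frechet_derivative \<phi> (at x)) (at x)"
    and "i \<in> Basis \<Longrightarrow> continuous_on S (\<lambda>x. frechet_derivative \<phi> (at x) i)"
    and "continuous_on S \<phi>"
proof -
  have c: "Ck k \<phi>" for k using assms by (simp add: test_functions_def)
  show "(\<phi> has_derivative frechet_derivative \<phi> (at x)) (at x)"
    using c[of 1] by (simp add: frechet_derivative_works)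
  show "i \<in> Basis \<Longrightarrow> continuous_on S (\<lambda>x. frechet_derivative \<phi> (at x) i)"
    using c[of 1] by (auto intro: continuous_on_subset)
  show "continuous_on S \<phi>"
    using c[of 0] by (auto intro: continuous_on_subset)
qed

lemma integration_by_parts_test_function:
  fixes v :: "'a::euclidean_space \<Rightarrow> real"
  assumes \<Omega>: "open \<Omega>" and \<phi>: "\<phi> \<in> test_functions \<Omega>"
    and v: "\<And>x. x \<in> \<Omega> \<Longrightarrow> (v has_derivative v' x) (at x)"
    and v': "continuous_on \<Omega> (\<lambda>x. v' x i)"
    and i: "i \<in> Basis"
  shows "(LINT x|lebesgue_on \<Omega>. v x * frechet_derivative \<phi> (at x) i) =
         - (LINT x|lebesgue_on \<Omega>. v' x i * \<phi> x)"
proof -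
  obtain K where K: "compact K" "K \<subseteq> \<Omega>" "\<And>x. x \<notin> K \<Longrightarrow> \<phi> x = 0"
    "\<And>x i. x \<notin> K \<Longrightarrow> frechet_derivative \<phi> (at x) i = 0"
    using \<phi> by (rule test_functionD) blast
  have cv: "continuous_on \<Omega> v"
    using v has_derivative_continuous by (blast intro: continuous_at_imp_continuous_on)
  define w where "w = (\<lambda>x. if x \<in> \<Omega> then v x * \<phi> x else 0)"
  define A where "A = (\<lambda>x. v x * frechet_derivative \<phi> (at x) i)"
  define B where "B = (\<lambda>x. v' x i * \<phi> x)"
  define w' where "w' = (\<lambda>x h. if x \<in> \<Omega>
    then v x * frechet_derivative \<phi> (at x) h + v' x h * \<phi> x else 0)"
  have cA: "continuous_on \<Omega> A" and cB: "continuous_on \<Omega> B"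
    unfolding A_def B_def using test_function_derivative(2,3)[OF \<phi>] i cv v'
    by (auto intro!: continuous_intros)
  have A0: "A x = 0" "B x = 0" if "x \<notin> K" for x using K that by (auto simp: A_def B_def)
  have w'AB: "w' x i = indicator K x *\<^sub>R A x + indicator K x *\<^sub>R B x" for x
    using K(2) A0[of x] by (auto simp: w'_def A_def B_def indicator_def)
  have "(w has_derivative w' x) (at x)" for x
  proof (cases "x \<in> \<Omega>")
    case True
    have "((\<lambda>x. v x * \<phi> x) has_derivative w' x) (at x)"
      using has_derivative_mult[OF v[OF True] test_function_derivative(1)[OF \<phi>]] True
      by (simp add: w'_def)
    then show ?thesis
      by (rule has_derivative_transform_within_open[OF _ \<Omega> True]) (simp add: w_def)
  next
    case False
    have "(w has_derivative (\<lambda>h. 0)) (at x)"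
      by (rule has_derivative_transform_within_open[OF has_derivative_const, where s = "- K"])
         (use False K compact_imp_closed[OF K(1)] in \<open>auto simp: open_Compl w_def\<close>)
    then show ?thesis using False by (simp add: w'_def)
  qed
  moreover have "continuous_on (\<Omega> \<union> - K) (\<lambda>x. w' x i)"
  proof (rule continuous_on_open_Un[OF \<Omega>])
    show "open (- K)" using compact_imp_closed[OF K(1)] by auto
    show "continuous_on \<Omega> (\<lambda>x. w' x i)"
      using continuous_on_add[OF cA cB] by (rule continuous_on_eq) (simp add: w'_def A_def B_def)
    show "continuous_on (- K) (\<lambda>x. w' x i)"
      using continuous_on_const[of "- K" 0] by (rule continuous_on_eq) (simp add: w'AB)
  qed
  then have "continuous_on UNIV (\<lambda>x. w' x i)"
    using K(2) by (metis Compl_partition sup_commute Un_UNIV_left compl_le_compl_iff sup.absorb_iff2 sup_assoc)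
  ultimately have "(LINT x|lborel. w' x i) = 0"
    by (rule integral_compactly_supported_derivative[where K = K])
       (use K i in \<open>auto simp: w_def\<close>)
  moreover have "continuous_on K A" "continuous_on K B"
    using cA cB K(2) continuous_on_subset by blast+
  ultimately show ?thesis
    unfolding w'AB
    using lebesgue_on_compact_support[OF \<Omega> K(1,2) \<open>continuous_on K A\<close>]
      lebesgue_on_compact_support[OF \<Omega> K(1,2) \<open>continuous_on K B\<close>] A0
    by (simp add: A_def B_def)
qed

lemma L1_loc_mult_continuous:
  fixes g :: "'a::euclidean_space \<Rightarrow> real"
  assumes \<Omega>: "open \<Omega>" and g: "g \<in> L1_loc \<Omega>"
    and K: "compact K" "K \<subseteq> \<Omega>" "\<And>x. x \<notin> K \<Longrightarrow> f x = 0" "continuous_on UNIV f"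
  shows "integrable (lebesgue_on \<Omega>) (\<lambda>x. g x * f x)"
proof -
  have "bounded (f ` K)"
    using K by (intro compact_imp_bounded compact_continuous_image) (auto intro: continuous_on_subset)
  then obtain M where M: "\<And>x. x \<in> K \<Longrightarrow> \<bar>f x\<bar> \<le> M" by (auto simp: bounded_iff)
  have gi: "integrable lebesgue (\<lambda>x. indicator K x * g x)"
    using g K by (auto simp: L1_loc_def set_integrable_def)
  have fm: "f \<in> borel_measurable lebesgue"
    using borel_measurable_continuous_onI[OF K(4)] by (simp add: measurable_completion)
  have "integrable lebesgue (\<lambda>x. indicator K x * g x * f x)"
  proof (rule Bochner_Integration.integrable_bound[OF integrable_mult_right[OF gi, of M]])
    show "(\<lambda>x. indicator K x * g x * f x) \<in> borel_measurable lebesgue"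
      using fm gi by measurable
    show "AE x in lebesgue. norm (indicator K x * g x * f x) \<le> norm (M * (indicator K x * g x))"
    proof (rule AE_I2)
      fix x
      show "norm (indicator K x * g x * f x) \<le> norm (M * (indicator K x * g x))"
      proof (cases "x \<in> K")
        case True
        then have "\<bar>f x\<bar> * \<bar>g x\<bar> \<le> \<bar>M\<bar> * \<bar>g x\<bar>" using M[of x] by (intro mult_right_mono) auto
        with True show ?thesis by (simp add: abs_mult mult.commute)
      qed simp
    qed
  qed
  moreover have "(\<lambda>x. indicator \<Omega> x *\<^sub>R (g x * f x)) = (\<lambda>x. indicator K x * g x * f x)"
    using K(2,3) by (intro ext) (auto simp: indicator_def)
  ultimately show ?thesis using \<Omega> by (simp add: integrable_restrict_space del: real_scaleR_def)
qed

lemma box_indicator_test_functions: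
  fixes a b :: "'a::euclidean_space"
  assumes "cbox a b \<subseteq> \<Omega>"
  obtains \<psi> :: "nat \<Rightarrow> 'a \<Rightarrow> real" where "\<And>n. \<psi> n \<in> test_functions \<Omega>"
    "\<And>n x. \<bar>\<psi> n x\<bar> \<le> indicator (cbox a b) x" "\<And>x. (\<lambda>n. \<psi> n x) \<longlonglongrightarrow> indicator (box a b) x"
proof -
  let ?E = "exp_cutoff 1"
  define \<psi> where "\<psi> = (\<lambda>(n::nat) x. \<Prod>i\<in>Basis.
    ?E (real (Suc n) * (x \<bullet> i - a \<bullet> i)) * ?E (real (Suc n) * (b \<bullet> i - x \<bullet> i)))"
  have E: "0 \<le> ?E t" "?E t \<le> 1" for t by (auto simp: exp_cutoff_def)
  have E0: "?E t \<noteq> 0 \<longleftrightarrow> t > 0" for t by (auto simp: exp_cutoff_def)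
  have supp: "x \<in> box a b" if "\<psi> n x \<noteq> 0" for n x
    using that by (auto simp: \<psi>_def E0 mem_box zero_less_mult_iff)
  have cl: "closure {x. \<psi> n x \<noteq> 0} \<subseteq> cbox a b" for n
    using supp box_subset_cbox by (intro closure_minimal) blast+
  show thesis
  proof (rule that[of \<psi>])
    show "\<psi> n \<in> test_functions \<Omega>" for n
    proof -
      have "Ck_on k UNIV (\<psi> n)" for k
        unfolding \<psi>_def
        by (intro Ck_on_prod Ck_on_mult open_UNIV Ck_on_cmult Ck_on_diff Ck_on_inner Ck_on_const
            Ck_on_compose[OF open_UNIV subset_UNIV _ Ck_on_exp_cutoff])
      moreover have "compact (closure {x. \<psi> n x \<noteq> 0})"
        using compact_cbox closed_closure cl[of n]
        by (metis compact_Int_closed inf.absorb_iff2)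
      ultimately show ?thesis using cl[of n] assms by (auto simp: test_functions_def Ck_on_UNIV)
    qed
    show "\<bar>\<psi> n x\<bar> \<le> indicator (cbox a b) x" for n x
    proof (cases "\<psi> n x = 0")
      case False
      have "0 \<le> \<psi> n x" "\<psi> n x \<le> 1"
        unfolding \<psi>_def by (intro prod_nonneg prod_le_1 conjI mult_nonneg_nonneg mult_le_one E ballI)+
      moreover have "x \<in> cbox a b" using supp[OF False] box_subset_cbox[of a b] by blast
      ultimately show ?thesis by simp
    qed simp
    show "(\<lambda>n. \<psi> n x) \<longlonglongrightarrow> indicator (box a b) x" for x
    proof (cases "x \<in> box a b")
      case True
      have lim: "(\<lambda>n. ?E (real (Suc n) * t)) \<longlonglongrightarrow> 1" if "t > 0" for t
      proof -
        have "(\<lambda>n. exp (- (inverse (real (Suc n)) * (1 / t)))) \<longlonglongrightarrow> exp (- (0 * (1 / t)))"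
          by (intro tendsto_intros LIMSEQ_inverse_real_of_nat)
        moreover have "?E (real (Suc n) * t) = exp (- (inverse (real (Suc n)) * (1 / t)))" for n
          using that by (simp add: exp_cutoff_def zero_less_mult_iff inverse_eq_divide del: of_nat_Suc)
        ultimately show ?thesis by simp
      qed
      have "(\<lambda>n. \<psi> n x) \<longlonglongrightarrow> (\<Prod>i\<in>(Basis :: 'a set). 1 * 1)"
        unfolding \<psi>_def by (intro tendsto_prod tendsto_mult lim) (use True in \<open>auto simp: mem_box\<close>)
      then show ?thesis using True by simp
    next
      case False
      then have "\<psi> n x = 0" for n using supp by blast
      then show ?thesis using False by simp
    qed
  qed
qed

lemma integral_box_eq_0:
  fixes g :: "'a::euclidean_space \<Rightarrow> real"
  assumes \<Omega>: "open \<Omega>" and g: "g \<in> L1_loc \<Omega>"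
    and 0: "\<And>\<phi>. \<phi> \<in> test_functions \<Omega> \<Longrightarrow> (LINT x|lebesgue_on \<Omega>. g x * \<phi> x) = 0"
    and ab: "cbox a b \<subseteq> \<Omega>"
  shows "(LINT x|lebesgue. indicator (box a b) x * g x) = 0"
proof -
  obtain \<psi> where \<psi>: "\<And>n. \<psi> n \<in> test_functions \<Omega>"
    "\<And>n x. \<bar>\<psi> n x\<bar> \<le> indicator (cbox a b) x" "\<And>x. (\<lambda>n. \<psi> n x) \<longlonglongrightarrow> indicator (box a b) x"
    using box_indicator_test_functions[OF ab] by blast
  have gi: "integrable lebesgue (\<lambda>x. indicator (cbox a b) x * g x)"
    using g ab by (auto simp: L1_loc_def set_integrable_def)
  have \<psi>m: "\<psi> n \<in> borel_measurable lebesgue" for n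
    using test_function_derivative(3)[OF \<psi>(1)[of n], of UNIV]
    by (simp add: measurable_completion borel_measurable_continuous_onI)
  have \<psi>0: "\<psi> n x = 0" if "x \<notin> cbox a b" for n x
    using \<psi>(2)[of n x] that by (simp add: indicator_def)
  have eq: "(\<lambda>x. indicator \<Omega> x *\<^sub>R (g x * \<psi> n x)) = (\<lambda>x. indicator (cbox a b) x * g x * \<psi> n x)" for n
    using ab \<psi>0[of _ n] by (intro ext) (auto simp: indicator_def)
  have eq': "indicator (cbox a b) x * g x * indicator (box a b) x = indicator (box a b) x * g x" for x
    using box_subset_cbox[of a b] by (auto simp: indicator_def)
  have "(\<lambda>n. LINT x|lebesgue. indicator (cbox a b) x * g x * \<psi> n x) \<longlonglongrightarrow>
      (LINT x|lebesgue. indicator (cbox a b) x * g x * indicator (box a b) x)"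
  proof (rule integral_dominated_convergence[where w = "\<lambda>x. \<bar>indicator (cbox a b) x * g x\<bar>"])
    show "AE x in lebesgue. norm (indicator (cbox a b) x * g x * \<psi> n x) \<le> \<bar>indicator (cbox a b) x * g x\<bar>" for n
    proof (rule AE_I2)
      fix x
      have "\<bar>\<psi> n x\<bar> \<le> 1" using order_trans[OF \<psi>(2)[of n x], of 1] by (simp add: indicator_le_1)
      then show "norm (indicator (cbox a b) x * g x * \<psi> n x) \<le> \<bar>indicator (cbox a b) x * g x\<bar>"
        by (auto simp: abs_mult indicator_def intro!: mult_left_le)
    qed
    show "(\<lambda>x. indicator (cbox a b) x * g x * \<psi> n x) \<in> borel_measurable lebesgue" for n
      using \<psi>m[of n] gi by measurable
    show "(\<lambda>x. indicator (cbox a b) x * g x * indicator (box a b) x) \<in> borel_measurable lebesgue"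
      by (intro borel_measurable_times[OF borel_measurable_integrable[OF gi]] borel_measurable_indicator) simp
    show "AE x in lebesgue. (\<lambda>n. indicator (cbox a b) x * g x * \<psi> n x) \<longlonglongrightarrow>
        indicator (cbox a b) x * g x * indicator (box a b) x"
      by (intro AE_I2 tendsto_mult tendsto_const \<psi>(3))
  qed (use gi in auto)
  moreover have "(LINT x|lebesgue. indicator (cbox a b) x * g x * \<psi> n x) = 0" for n
    using 0[OF \<psi>(1)[of n]] \<Omega> by (simp add: integral_restrict_space eq del: real_scaleR_def)
  ultimately show ?thesis using LIMSEQ_unique[OF tendsto_const] by (force simp: eq')
qed

lemma AE_eq_0_if_integral_boxes_eq_0:
  fixes g :: "'a::euclidean_space \<Rightarrow> real"
  assumes g: "integrable lborel g"
    and 0: "\<And>a b. (LINT x|lborel. indicator (box a b) x * g x) = 0" and 1: "(LINT x|lborel. g x) = 0"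
  shows "AE x in lborel. g x = 0"
proof (rule sigma_finite_measure.density_zero[OF sigma_finite_lborel g])
  fix A assume "A \<in> sets (lborel :: 'a measure)"
  let ?E = "insert UNIV {box a b :: 'a set | a b. True}"
  have "sets borel = sigma_sets UNIV (range (\<lambda>(a, b). box a b :: 'a set))"
    by (subst borel_eq_box) simp
  also have "\<dots> = sigma_sets UNIV ?E"
    by (rule sigma_sets_eqI) (auto intro: sigma_sets_top sigma_sets.Basic)
  finally have sets_eq: "sets borel = sigma_sets UNIV ?E" .
  have Int: "Int_stable ?E"
  proof (rule Int_stableI)
    fix A B :: "'a set" assume "A \<in> ?E" "B \<in> ?E"
    then consider "A = UNIV" | "B = UNIV" | p q r s where "A = box p q" "B = box r s" by blast
    then show "A \<inter> B \<in> ?E"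
    proof cases
      case 3
      then show ?thesis unfolding 3 box_Int_box by blast
    qed (use \<open>A \<in> ?E\<close> \<open>B \<in> ?E\<close> in auto)
  qed
  have int: "set_integrable lborel B g" if "B \<in> sets borel" for B
    using g that integrable_mult_indicator[of B lborel g] by (simp add: set_integrable_def)
  have E: "?E \<subseteq> Pow UNIV" by simp
  have "A \<in> sigma_sets UNIV ?E" using \<open>A \<in> _\<close> sets_eq by simp
  with Int E show "set_lebesgue_integral lborel A g = 0"
  proof (induction A rule: sigma_sets_induct_disjoint)
    case (basic A)
    then show ?case using 0 1 by (auto simp: set_lebesgue_integral_def)
  next
    case empty
    then show ?case by (simp add: set_lebesgue_integral_def)
  next
    case (compl A)
    then have "A \<in> sets borel" using sets_eq by simp
    have "(\<lambda>x. indicator (UNIV - A) x *\<^sub>R g x) = (\<lambda>x. g x - indicator A x *\<^sub>R g x)"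
      by (auto simp: indicator_def)
    then show ?case
      using compl(2) 1 g int[OF \<open>A \<in> sets borel\<close>]
      by (simp add: set_lebesgue_integral_def set_integrable_def)
  next
    case (union A)
    have A: "A i \<in> sets borel" for i using union(2) sets_eq by auto
    then have "(\<Union>i. A i) \<in> sets borel" by auto
    then have "set_lebesgue_integral lborel (\<Union>i. A i) g = (\<Sum>i. set_lebesgue_integral lborel (A i) g)"
      using union(1) A int by (intro lebesgue_integral_countable_add) (auto simp: disjoint_family_on_def)
    then show ?case using union(3) by simp
  qed
qed

lemma fundamental_lemma_calculus_of_variations:
  fixes g :: "'a::euclidean_space \<Rightarrow> real"
  assumes \<Omega>: "open \<Omega>" and g: "g \<in> L1_loc \<Omega>"
    and 0: "\<And>\<phi>. \<phi> \<in> test_functions \<Omega> \<Longrightarrow> (LINT x|lebesgue_on \<Omega>. g x * \<phi> x) = 0"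
  shows "AE x in lebesgue_on \<Omega>. g x = 0"
proof -
  have box: "AE x in lebesgue. x \<in> cbox c d \<longrightarrow> g x = 0" if cd: "cbox c d \<subseteq> \<Omega>" for c d
  proof -
    have "set_integrable lebesgue (cbox c d) g" using g cd by (auto simp: L1_loc_def)
    then have "set_integrable lebesgue (box c d) g"
      by (rule set_integrable_subset) (auto simp: box_subset_cbox)
    then have Gi: "integrable lebesgue (\<lambda>x. indicator (box c d) x * g x)"
      by (simp add: set_integrable_def)
    then obtain G where G: "G \<in> borel_measurable lborel"
      and Geq: "AE x in lborel. indicator (box c d) x * g x = G x"
      using completion_ex_borel_measurable_real[of "\<lambda>x. indicator (box c d) x * g x" lborel]
        borel_measurable_integrable by blast
    have Geq': "AE x in lebesgue. indicator (box c d) x * g x = G x"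
      by (rule AE_completion[OF Geq])
    have "integrable lebesgue G"
      using Gi
    proof (rule integrable_cong_AE_imp)
      show "G \<in> borel_measurable lebesgue" using G by (rule measurable_completion)
    qed (use Geq' in auto)
    then have Gi': "integrable lborel G" using integrable_completion[OF G] by simp
    have Gint: "(LINT x|lborel. indicator B x * G x) =
        (LINT x|lebesgue. indicator B x * (indicator (box c d) x * g x))"
      if B: "B \<in> sets borel" for B
    proof -
      have "(\<lambda>x. indicator B x * G x) \<in> borel_measurable lborel" using G B by (intro borel_measurable_times borel_measurable_indicator) auto
      then have "(LINT x|lborel. indicator B x * G x) = (LINT x|lebesgue. indicator B x * G x)"
        by (rule integral_completion[symmetric])
      also have "\<dots> = (LINT x|lebesgue. indicator B x * (indicator (box c d) x * g x))"
      proof (rule integral_cong_AE)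
        show "(\<lambda>x. indicator B x * G x) \<in> borel_measurable lebesgue"
          using G B by (intro measurable_completion borel_measurable_times borel_measurable_indicator) auto
        show "(\<lambda>x. indicator B x * (indicator (box c d) x * g x)) \<in> borel_measurable lebesgue"
          by (intro borel_measurable_times borel_measurable_indicator borel_measurable_integrable[OF Gi])
             (use B in simp)
        show "AE x in lebesgue. indicator B x * G x = indicator B x * (indicator (box c d) x * g x)"
          using Geq' by eventually_elim simp
      qed
      finally show ?thesis .
    qed
    have "AE x in lborel. G x = 0"
    proof (rule AE_eq_0_if_integral_boxes_eq_0[OF Gi'])
      show "(LINT x|lborel. indicator (box a b) x * G x) = 0" for a b
      proof -
        obtain p q where pq: "box a b \<inter> box c d = box p q" by (rule that[OF box_Int_box])
        have "(LINT x|lborel. indicator (box a b) x * G x) = (LINT x|lebesgue. indicator (box p q) x * g x)"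
          unfolding Gint[OF borel_open[OF open_box]] mult.assoc[symmetric] indicator_inter_arith[symmetric] pq ..
        also have "\<dots> = 0"
        proof (cases "box p q = {}")
          case False
          have "box p q \<subseteq> cbox c d" using pq box_subset_cbox[of c d] by blast
          then have "closure (box p q) \<subseteq> cbox c d" by (intro closure_minimal) auto
          then have "cbox p q \<subseteq> \<Omega>" unfolding closure_box[OF False] using cd by (rule subset_trans)
          then show ?thesis using integral_box_eq_0[OF \<Omega> g 0] by blast
        qed simp
        finally show ?thesis .
      qed
      show "(LINT x|lborel. G x) = 0"
        using Gint[of UNIV] integral_box_eq_0[OF \<Omega> g 0 cd] by simp
    qed
    then have "AE x in lebesgue. G x = 0" by (rule AE_completion)
    moreover have "AE x in lebesgue. x \<notin> cbox c d - box c d"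
      using negligible_frontier_interval[of c d] by (intro AE_not_in) (simp add: negligible_iff_null_sets)
    ultimately show ?thesis using Geq' by eventually_elim (auto simp: indicator_def split: if_splits)
  qed
  obtain \<D> where \<D>: "countable \<D>" "\<D> \<subseteq> Pow \<Omega>" "\<And>X. X \<in> \<D> \<Longrightarrow> \<exists>a b. X = cbox a b" "\<Union>\<D> = \<Omega>"
    using open_countable_Union_open_cbox[OF \<Omega>] by blast
  have "AE x in lebesgue. \<forall>X\<in>\<D>. x \<in> X \<longrightarrow> g x = 0"
  proof (rule AE_ball_countable'[OF _ \<D>(1)])
    fix X assume "X \<in> \<D>"
    then show "AE x in lebesgue. x \<in> X \<longrightarrow> g x = 0" using \<D>(2,3) box by blast
  qed
  then have "AE x in lebesgue. x \<in> \<Omega> \<longrightarrow> g x = 0"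
    by eventually_elim (use \<D>(4) in blast)
  then show ?thesis using \<Omega> by (simp add: AE_restrict_space_iff)
qed

subsection \<open>Weak gradients and Sobolev functions\<close>

lemma borel_measurable_lebesgue_on_AE:
  fixes f g :: "'a::euclidean_space \<Rightarrow> 'b::euclidean_space"
  assumes "open \<Omega>" "f \<in> borel_measurable (lebesgue_on \<Omega>)" "AE x in lebesgue_on \<Omega>. f x = g x"
  shows "g \<in> borel_measurable (lebesgue_on \<Omega>)"
proof -
  have "(\<lambda>x. indicator \<Omega> x *\<^sub>R f x) \<in> borel_measurable lebesgue"
    using assms(1,2) by (simp add: borel_measurable_restrict_space_iff)
  moreover have "AE x in lebesgue. indicator \<Omega> x *\<^sub>R f x = indicator \<Omega> x *\<^sub>R g x"
  proof -
    have "AE x in lebesgue. x \<in> \<Omega> \<longrightarrow> f x = g x"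
      using assms(1,3) by (simp add: AE_restrict_space_iff)
    then show ?thesis by eventually_elim (auto simp: indicator_def)
  qed
  ultimately have "(\<lambda>x. indicator \<Omega> x *\<^sub>R g x) \<in> borel_measurable lebesgue"
    by (rule borel_measurable_AE)
  then show ?thesis using assms(1) by (simp add: borel_measurable_restrict_space_iff)
qed

lemma integrable_imp_L1_loc:
  assumes "open \<Omega>" "integrable (lebesgue_on \<Omega>) f"
  shows "f \<in> L1_loc \<Omega>"
proof -
  have "set_integrable lebesgue \<Omega> f"
    using assms by (simp add: integrable_restrict_space set_integrable_def)
  then show ?thesis
    unfolding L1_loc_def by (auto intro!: set_integrable_subset[where A = \<Omega>] lmeasurable_compact fmeasurableD)
qed

lemma continuous_imp_L1_loc:
  assumes "continuous_on \<Omega> f"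
  shows "f \<in> L1_loc \<Omega>"
proof -
  have "set_integrable lebesgue K f" if K: "compact K" "K \<subseteq> \<Omega>" for K
  proof -
    have *: "integrable lborel (\<lambda>x. indicator K x *\<^sub>R f x)"
      using assms K by (intro borel_integrable_compact) (auto intro: continuous_on_subset)
    then show ?thesis
      unfolding set_integrable_def by (simp add: integrable_completion borel_measurable_integrable)
  qed
  then show ?thesis by (simp add: L1_loc_def)
qed

lemma L1_loc_diff: "f \<in> L1_loc \<Omega> \<Longrightarrow> g \<in> L1_loc \<Omega> \<Longrightarrow> (\<lambda>x. f x - g x) \<in> L1_loc \<Omega>"
  by (auto simp: L1_loc_def set_integrable_def scaleR_diff_right)

lemma L1_loc_inner:
  assumes "g \<in> L1_loc \<Omega>"
  shows "(\<lambda>x. g x \<bullet> i) \<in> L1_loc \<Omega>"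
  unfolding L1_loc_def set_integrable_def
proof (clarify)
  fix K assume "compact K" "K \<subseteq> \<Omega>"
  then have "integrable lebesgue (\<lambda>x. indicator K x *\<^sub>R g x)"
    using assms by (simp add: L1_loc_def set_integrable_def)
  then have "integrable lebesgue (\<lambda>x. (indicator K x *\<^sub>R g x) \<bullet> i)"
    by (intro integrable_inner_left) auto
  then show "integrable lebesgue (\<lambda>x. indicator K x *\<^sub>R (g x \<bullet> i))" by simp
qed

lemma L1_loc_mult_test_function:
  fixes u :: "'a::euclidean_space \<Rightarrow> real"
  assumes "open \<Omega>" "u \<in> L1_loc \<Omega>" "\<phi> \<in> test_functions \<Omega>"
  shows "integrable (lebesgue_on \<Omega>) (\<lambda>x. u x * \<phi> x)"
    and "i \<in> Basis \<Longrightarrow> integrable (lebesgue_on \<Omega>) (\<lambda>x. u x * frechet_derivative \<phi> (at x) i)"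
proof -
  obtain K where K: "compact K" "K \<subseteq> \<Omega>" "\<And>x. x \<notin> K \<Longrightarrow> \<phi> x = 0"
    "\<And>x i. x \<notin> K \<Longrightarrow> frechet_derivative \<phi> (at x) i = 0"
    using assms(3) by (rule test_functionD) blast
  show "integrable (lebesgue_on \<Omega>) (\<lambda>x. u x * \<phi> x)"
    by (intro L1_loc_mult_continuous[OF assms(1,2) K(1-3)] test_function_derivative(3)[OF assms(3)])
  show "integrable (lebesgue_on \<Omega>) (\<lambda>x. u x * frechet_derivative \<phi> (at x) i)" if "i \<in> Basis"
    by (intro L1_loc_mult_continuous[OF assms(1,2) K(1,2,4)] test_function_derivative(2)[OF assms(3) that])
qed

lemma test_function_bounded:
  assumes "\<phi> \<in> test_functions \<Omega>" "i \<in> Basis"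
  obtains M where "\<And>x. \<bar>\<phi> x\<bar> \<le> M" "\<And>x. \<bar>frechet_derivative \<phi> (at x) i\<bar> \<le> M"
proof -
  obtain K where K: "compact K" "K \<subseteq> \<Omega>" "\<And>x. x \<notin> K \<Longrightarrow> \<phi> x = 0"
    "\<And>x i. x \<notin> K \<Longrightarrow> frechet_derivative \<phi> (at x) i = 0"
    using assms(1) by (rule test_functionD) blast
  have *: "\<exists>M. \<forall>x. \<bar>f x\<bar> \<le> M" if "continuous_on K f" "\<And>x. x \<notin> K \<Longrightarrow> f x = 0" for f :: "_ \<Rightarrow> real"
  proof -
    have "bounded (f ` K)" using that K by (intro compact_imp_bounded compact_continuous_image)
    then obtain M where "M > 0" "\<And>x. x \<in> K \<Longrightarrow> \<bar>f x\<bar> \<le> M" by (auto simp: bounded_pos)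
    then have "\<bar>f x\<bar> \<le> M" for x using that(2)[of x] by (cases "x \<in> K") auto
    then show ?thesis by blast
  qed
  obtain M1 where "\<And>x. \<bar>\<phi> x\<bar> \<le> M1"
    using *[OF test_function_derivative(3)[OF assms(1)] K(3)] by blast
  moreover obtain M2 where "\<And>x. \<bar>frechet_derivative \<phi> (at x) i\<bar> \<le> M2"
    using *[OF test_function_derivative(2)[OF assms] K(4)] by blast
  ultimately show thesis using that[of "max M1 M2"] by (simp add: le_max_iff_disj)
qed

lemma has_weak_grad_unique:
  assumes \<Omega>: "open \<Omega>" and g: "has_weak_grad \<Omega> u g" and h: "has_weak_grad \<Omega> u h"
  shows "AE x in lebesgue_on \<Omega>. g x = h x"
proof -
  have "AE x in lebesgue_on \<Omega>. (g x - h x) \<bullet> i = 0" if i: "i \<in> Basis" for i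
  proof (rule fundamental_lemma_calculus_of_variations[OF \<Omega>])
    have gi: "(\<lambda>x. g x \<bullet> i) \<in> L1_loc \<Omega>" "(\<lambda>x. h x \<bullet> i) \<in> L1_loc \<Omega>"
      using g h by (auto simp: has_weak_grad_def intro: L1_loc_inner)
    then show "(\<lambda>x. (g x - h x) \<bullet> i) \<in> L1_loc \<Omega>" by (simp add: inner_diff_left L1_loc_diff)
    fix \<phi> assume \<phi>: "\<phi> \<in> test_functions \<Omega>"
    have "(LINT x|lebesgue_on \<Omega>. (g x \<bullet> i) * \<phi> x) = (LINT x|lebesgue_on \<Omega>. (h x \<bullet> i) * \<phi> x)"
      using g h i \<phi> by (simp add: has_weak_grad_def)
    then show "(LINT x|lebesgue_on \<Omega>. (g x - h x) \<bullet> i * \<phi> x) = 0"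
      using L1_loc_mult_test_function(1)[OF \<Omega> _ \<phi>] gi by (simp add: inner_diff_left left_diff_distrib)
  qed
  then have "AE x in lebesgue_on \<Omega>. \<forall>i\<in>Basis. (g x - h x) \<bullet> i = 0"
    by (intro AE_finite_allI) auto
  then show ?thesis by eventually_elim (rule euclidean_eqI, simp add: inner_diff_left)
qed

lemma has_weak_grad_weak_grad: "has_weak_grad \<Omega> u g \<Longrightarrow> has_weak_grad \<Omega> u (weak_grad \<Omega> u)"
  unfolding weak_grad_def by (rule someI[of "has_weak_grad \<Omega> u"])

lemma weak_grad_AE_eq:
  "open \<Omega> \<Longrightarrow> has_weak_grad \<Omega> u g \<Longrightarrow> AE x in lebesgue_on \<Omega>. weak_grad \<Omega> u x = g x"
  by (intro has_weak_grad_unique[where u = u] has_weak_grad_weak_grad)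

lemma weak_grad_measurable:
  assumes "open \<Omega>" "has_weak_grad \<Omega> u g" "g \<in> borel_measurable (lebesgue_on \<Omega>)"
  shows "weak_grad \<Omega> u \<in> borel_measurable (lebesgue_on \<Omega>)"
proof (rule borel_measurable_lebesgue_on_AE[OF assms(1,3)])
  show "AE x in lebesgue_on \<Omega>. g x = weak_grad \<Omega> u x"
    using weak_grad_AE_eq[OF assms(1,2)] by eventually_elim simp
qed

lemma has_weak_grad_diff:
  assumes \<Omega>: "open \<Omega>" and g: "has_weak_grad \<Omega> u g" and h: "has_weak_grad \<Omega> v h"
  shows "has_weak_grad \<Omega> (\<lambda>x. u x - v x) (\<lambda>x. g x - h x)"
  unfolding has_weak_grad_def
proof (intro conjI ballI)
  have L: "u \<in> L1_loc \<Omega>" "v \<in> L1_loc \<Omega>" "g \<in> L1_loc \<Omega>" "h \<in> L1_loc \<Omega>"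
    using g h by (auto simp: has_weak_grad_def)
  then show "(\<lambda>x. u x - v x) \<in> L1_loc \<Omega>" "(\<lambda>x. g x - h x) \<in> L1_loc \<Omega>"
    by (auto intro: L1_loc_diff)
  fix \<phi> i assume \<phi>: "\<phi> \<in> test_functions \<Omega>" and i: "i \<in> (Basis :: 'a set)"
  note int = L1_loc_mult_test_function[OF \<Omega> _ \<phi>]
  have gi: "integrable (lebesgue_on \<Omega>) (\<lambda>x. g x \<bullet> i * \<phi> x)"
    "integrable (lebesgue_on \<Omega>) (\<lambda>x. h x \<bullet> i * \<phi> x)"
    using L by (auto intro!: int L1_loc_inner)
  show "(LINT x|lebesgue_on \<Omega>. (u x - v x) * frechet_derivative \<phi> (at x) i) =
      - (LINT x|lebesgue_on \<Omega>. (g x - h x) \<bullet> i * \<phi> x)"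
    using g h \<phi> i L int gi by (simp add: left_diff_distrib inner_diff_left has_weak_grad_def)
qed

lemma has_weak_grad_differentiable:
  fixes v :: "'a::euclidean_space \<Rightarrow> real"
  assumes \<Omega>: "open \<Omega>" and v: "\<And>x. x \<in> \<Omega> \<Longrightarrow> (v has_derivative v' x) (at x)"
    and v': "\<And>i. i \<in> Basis \<Longrightarrow> continuous_on \<Omega> (\<lambda>x. v' x i)"
  shows "has_weak_grad \<Omega> v (\<lambda>x. \<Sum>i\<in>Basis. v' x i *\<^sub>R i)"
  unfolding has_weak_grad_def
proof (intro conjI ballI)
  show "v \<in> L1_loc \<Omega>"
    using v has_derivative_continuous
    by (blast intro: continuous_imp_L1_loc continuous_at_imp_continuous_on)
  show "(\<lambda>x. \<Sum>i\<in>Basis. v' x i *\<^sub>R i) \<in> L1_loc \<Omega>"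
    by (intro continuous_imp_L1_loc continuous_intros v')
  fix \<phi> i assume \<phi>: "\<phi> \<in> test_functions \<Omega>" and i: "i \<in> (Basis :: 'a set)"
  show "(LINT x|lebesgue_on \<Omega>. v x * frechet_derivative \<phi> (at x) i) =
      - (LINT x|lebesgue_on \<Omega>. (\<Sum>i\<in>Basis. v' x i *\<^sub>R i) \<bullet> i * \<phi> x)"
    using integration_by_parts_test_function[OF \<Omega> \<phi> v v'[OF i] i] i
    by (simp add: inner_sum_left_Basis)
qed

lemma has_weak_grad_dominated_limit:
  fixes u :: "'a::euclidean_space \<Rightarrow> real" and V :: "nat \<Rightarrow> 'a \<Rightarrow> real"
  assumes \<Omega>: "open \<Omega>" and V: "\<And>n. has_weak_grad \<Omega> (V n) (G n)"
    and meas: "\<And>n. V n \<in> borel_measurable (lebesgue_on \<Omega>)" "\<And>n. G n \<in> borel_measurable (lebesgue_on \<Omega>)"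
      "u \<in> borel_measurable (lebesgue_on \<Omega>)" "g \<in> borel_measurable (lebesgue_on \<Omega>)"
    and lim: "AE x in lebesgue_on \<Omega>. (\<lambda>n. V n x) \<longlonglongrightarrow> u x" "AE x in lebesgue_on \<Omega>. (\<lambda>n. G n x) \<longlonglongrightarrow> g x"
    and w: "integrable (lebesgue_on \<Omega>) w"
      "\<And>n. AE x in lebesgue_on \<Omega>. \<bar>V n x\<bar> \<le> w x" "\<And>n. AE x in lebesgue_on \<Omega>. norm (G n x) \<le> w x"
  shows "has_weak_grad \<Omega> u g"
  unfolding has_weak_grad_def
proof (intro conjI ballI)
  show "u \<in> L1_loc \<Omega>"
    using integrable_dominated_convergence[OF meas(3,1) w(1) lim(1)] w(2) \<Omega>
    by (simp add: integrable_imp_L1_loc)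
  show "g \<in> L1_loc \<Omega>"
    using integrable_dominated_convergence[OF meas(4,2) w(1) lim(2)] w(3) \<Omega>
    by (simp add: integrable_imp_L1_loc)
  fix \<phi> i assume \<phi>: "\<phi> \<in> test_functions \<Omega>" and i: "i \<in> (Basis :: 'a set)"
  obtain M where M: "\<And>x. \<bar>\<phi> x\<bar> \<le> M" "\<And>x. \<bar>frechet_derivative \<phi> (at x) i\<bar> \<le> M"
    using test_function_bounded[OF \<phi> i] by blast
  have \<phi>m: "\<phi> \<in> borel_measurable (lebesgue_on \<Omega>)"
      "(\<lambda>x. frechet_derivative \<phi> (at x) i) \<in> borel_measurable (lebesgue_on \<Omega>)"
    using test_function_derivative(2,3)[OF \<phi>] i \<Omega>
    by (auto intro!: continuous_imp_measurable_on_sets_lebesgue)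
  have Mw: "integrable (lebesgue_on \<Omega>) (\<lambda>x. w x * M)" using w(1) by simp
  have 1: "(\<lambda>n. LINT x|lebesgue_on \<Omega>. V n x * frechet_derivative \<phi> (at x) i) \<longlonglongrightarrow>
      (LINT x|lebesgue_on \<Omega>. u x * frechet_derivative \<phi> (at x) i)"
  proof (rule integral_dominated_convergence[OF _ _ Mw])
    show "AE x in lebesgue_on \<Omega>. norm (V n x * frechet_derivative \<phi> (at x) i) \<le> w x * M" for n
      using w(2)[of n] by eventually_elim (auto simp: abs_mult intro!: mult_mono M)
    show "AE x in lebesgue_on \<Omega>. (\<lambda>n. V n x * frechet_derivative \<phi> (at x) i) \<longlonglongrightarrow>
        u x * frechet_derivative \<phi> (at x) i"
      using lim(1) by eventually_elim (intro tendsto_intros)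
  qed (use meas \<phi>m in measurable)
  have 2: "(\<lambda>n. LINT x|lebesgue_on \<Omega>. (G n x \<bullet> i) * \<phi> x) \<longlonglongrightarrow> (LINT x|lebesgue_on \<Omega>. (g x \<bullet> i) * \<phi> x)"
  proof (rule integral_dominated_convergence[OF _ _ Mw])
    show "AE x in lebesgue_on \<Omega>. norm ((G n x \<bullet> i) * \<phi> x) \<le> w x * M" for n
      using w(3)[of n]
    proof eventually_elim
      fix x assume "norm (G n x) \<le> w x"
      then have "\<bar>G n x \<bullet> i\<bar> \<le> w x" using Basis_le_norm[OF i, of "G n x"] by simp
      then show "norm ((G n x \<bullet> i) * \<phi> x) \<le> w x * M" by (auto simp: abs_mult intro!: mult_mono M)
    qed
    show "AE x in lebesgue_on \<Omega>. (\<lambda>n. (G n x \<bullet> i) * \<phi> x) \<longlonglongrightarrow> (g x \<bullet> i) * \<phi> x"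
      using lim(2) by eventually_elim (intro tendsto_intros)
  qed (use meas \<phi>m in measurable)
  have "(LINT x|lebesgue_on \<Omega>. V n x * frechet_derivative \<phi> (at x) i) =
      - (LINT x|lebesgue_on \<Omega>. (G n x \<bullet> i) * \<phi> x)" for n
    using V[of n] \<phi> i by (simp add: has_weak_grad_def)
  then show "(LINT x|lebesgue_on \<Omega>. u x * frechet_derivative \<phi> (at x) i) =
      - (LINT x|lebesgue_on \<Omega>. (g x \<bullet> i) * \<phi> x)"
    using LIMSEQ_unique[OF 1] tendsto_minus[OF 2] by simp
qed

definition gradient :: "('a::euclidean_space \<Rightarrow> real) \<Rightarrow> 'a \<Rightarrow> 'a" where
  "gradient \<phi> x = (\<Sum>i\<in>Basis. frechet_derivative \<phi> (at x) i *\<^sub>R i)"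

lemma inner_gradient: "i \<in> Basis \<Longrightarrow> gradient \<phi> x \<bullet> i = frechet_derivative \<phi> (at x) i"
  by (simp add: gradient_def inner_sum_left_Basis)

lemma gradient_eqI:
  assumes "(\<phi> has_derivative (\<lambda>h. g \<bullet> h)) (at x)"
  shows "gradient \<phi> x = g"
  unfolding gradient_def frechet_derivative_at[OF assms, symmetric]
  by (simp add: euclidean_representation)

lemma continuous_on_gradient: "\<phi> \<in> test_functions \<Omega> \<Longrightarrow> continuous_on S (gradient \<phi>)"
  unfolding gradient_def by (intro continuous_intros test_function_derivative(2))

lemma has_weak_grad_test_function:
  assumes "open \<Omega>" "\<phi> \<in> test_functions \<Omega>"
  shows "has_weak_grad \<Omega> \<phi> (gradient \<phi>)"
  unfolding gradient_def
  by (intro has_weak_grad_differentiable assms test_function_derivative[OF assms(2)])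

lemma Lp_2_iff:
  fixes f :: "'a::euclidean_space \<Rightarrow> 'b::euclidean_space"
  shows "f \<in> Lp 2 \<Omega> \<longleftrightarrow> f \<in> borel_measurable (lebesgue_on \<Omega>) \<and> integrable (lebesgue_on \<Omega>) (\<lambda>x. (norm (f x))\<^sup>2)"
  by (simp add: Lp_def powr_numeral)

lemma integrable_mult_Lp_2:
  fixes f g :: "'a::euclidean_space \<Rightarrow> real"
  assumes "f \<in> Lp 2 \<Omega>" "g \<in> Lp 2 \<Omega>"
  shows "integrable (lebesgue_on \<Omega>) (\<lambda>x. f x * g x)"
proof (rule Bochner_Integration.integrable_bound)
  show "integrable (lebesgue_on \<Omega>) (\<lambda>x. (f x)\<^sup>2 + (g x)\<^sup>2)"
    using assms by (auto simp: Lp_2_iff)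
  have "2 * \<bar>f x * g x\<bar> \<le> (f x)\<^sup>2 + (g x)\<^sup>2" for x
    using sum_squares_bound[of "\<bar>f x\<bar>" "\<bar>g x\<bar>"] by (simp add: abs_mult)
  then have "\<bar>f x * g x\<bar> \<le> (f x)\<^sup>2 + (g x)\<^sup>2" for x
    by (smt (verit) abs_ge_zero)
  then show "AE x in lebesgue_on \<Omega>. norm (f x * g x) \<le> norm ((f x)\<^sup>2 + (g x)\<^sup>2)"
    by (auto intro: order_trans[OF _ abs_ge_self])
qed (use assms in \<open>auto simp: Lp_2_iff\<close>)

lemma Lp_2_norm: "f \<in> Lp 2 \<Omega> \<Longrightarrow> (\<lambda>x. norm (f x)) \<in> Lp 2 \<Omega>"
  by (auto simp: Lp_2_iff)

lemma Lp_2_bounded_by: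
  assumes "g \<in> borel_measurable (lebesgue_on \<Omega>)" "f \<in> Lp 2 \<Omega>"
    "AE x in lebesgue_on \<Omega>. norm (g x) \<le> norm (f x)"
  shows "g \<in> Lp 2 \<Omega>"
proof -
  have "integrable (lebesgue_on \<Omega>) (\<lambda>x. (norm (g x))\<^sup>2)"
  proof (rule Bochner_Integration.integrable_bound)
    show "integrable (lebesgue_on \<Omega>) (\<lambda>x. (norm (f x))\<^sup>2)" using assms(2) by (simp add: Lp_2_iff)
    show "AE x in lebesgue_on \<Omega>. norm ((norm (g x))\<^sup>2) \<le> norm ((norm (f x))\<^sup>2)"
      using assms(3) by eventually_elim (simp add: power_mono)
  qed (use assms(1) in measurable)
  then show ?thesis using assms(1) by (simp add: Lp_2_iff)
qed

lemma Lp_2_diff: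
  fixes f g :: "'a::euclidean_space \<Rightarrow> 'b::euclidean_space"
  assumes "f \<in> Lp 2 \<Omega>" "g \<in> Lp 2 \<Omega>"
  shows "(\<lambda>x. f x - g x) \<in> Lp 2 \<Omega>"
proof (rule Lp_2_bounded_by)
  have "integrable (lebesgue_on \<Omega>) (\<lambda>x. (norm (f x))\<^sup>2 + (norm (g x))\<^sup>2 + 2 * (norm (f x) * norm (g x)))"
    using assms integrable_mult_Lp_2[OF Lp_2_norm[OF assms(1)] Lp_2_norm[OF assms(2)]]
    by (auto simp: Lp_2_iff)
  then show "(\<lambda>x. norm (f x) + norm (g x)) \<in> Lp 2 \<Omega>"
    using assms by (auto simp: Lp_2_iff power2_sum algebra_simps)
  show "AE x in lebesgue_on \<Omega>. norm (f x - g x) \<le> norm (norm (f x) + norm (g x))"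
    by (simp add: norm_triangle_ineq4)
qed (use assms in \<open>auto simp: Lp_2_iff\<close>)

lemma integral_le_L2:
  fixes f :: "'a::euclidean_space \<Rightarrow> 'b::euclidean_space"
  assumes "finite_measure (lebesgue_on \<Omega>)" "f \<in> Lp 2 \<Omega>"
  shows "integrable (lebesgue_on \<Omega>) (\<lambda>x. norm (f x))"
    and "(LINT x|lebesgue_on \<Omega>. norm (f x)) \<le>
      sqrt ((LINT x|lebesgue_on \<Omega>. (norm (f x))\<^sup>2) * (measure (lebesgue_on \<Omega>) (space (lebesgue_on \<Omega>)) + 1))"
proof -
  interpret finite_measure "lebesgue_on \<Omega>" by fact
  have 2: "integrable (lebesgue_on \<Omega>) (\<lambda>x. (norm (f x))\<^sup>2)" using assms by (simp add: Lp_2_iff)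
  have "(\<lambda>x. 1 :: real) \<in> Lp 2 \<Omega>" by (simp add: Lp_2_iff)
  then show 1: "integrable (lebesgue_on \<Omega>) (\<lambda>x. norm (f x))"
    using integrable_mult_Lp_2[OF Lp_2_norm[OF assms(2)], of "\<lambda>x. 1"] by simp
  define V where "V = measure (lebesgue_on \<Omega>) (space (lebesgue_on \<Omega>))"
  define I where "I = (LINT x|lebesgue_on \<Omega>. norm (f x))"
  define A where "A = (LINT x|lebesgue_on \<Omega>. (norm (f x))\<^sup>2)"
  define m where "m = I / (V + 1)"
  have V: "V + 1 > 0" by (simp add: V_def add_nonneg_pos)
  have "0 \<le> (LINT x|lebesgue_on \<Omega>. (norm (f x) - m)\<^sup>2)" by simp
  also have "\<dots> = (LINT x|lebesgue_on \<Omega>. (norm (f x))\<^sup>2 - 2 * m * norm (f x) + m\<^sup>2)"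
    by (simp add: power2_diff algebra_simps)
  also have "\<dots> = A - 2 * m * I + V * m\<^sup>2"
    using 1 2 by (simp add: A_def I_def V_def)
  also have "\<dots> \<le> A - 2 * m * I + (V + 1) * m\<^sup>2" by (simp add: algebra_simps)
  also have "\<dots> = A - I\<^sup>2 / (V + 1)"
  proof -
    have "I = m * (V + 1)" using V by (simp add: m_def)
    moreover have "I\<^sup>2 / (V + 1) = m * I" by (simp add: m_def power2_eq_square)
    ultimately show ?thesis by (simp add: power2_eq_square algebra_simps)
  qed
  finally have "I\<^sup>2 \<le> A * (V + 1)" using V by (simp add: field_simps)
  then show "I \<le> sqrt (A * (V + 1))" by (rule real_le_rsqrt)
qed

lemma W12_norm_diff:
  assumes \<Omega>: "open \<Omega>" and u: "has_weak_grad \<Omega> u g" and v: "has_weak_grad \<Omega> v h"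
    and m: "g \<in> borel_measurable (lebesgue_on \<Omega>)" "h \<in> borel_measurable (lebesgue_on \<Omega>)"
  shows "W12_norm \<Omega> (\<lambda>x. u x - v x) =
    sqrt ((LINT x|lebesgue_on \<Omega>. (u x - v x)\<^sup>2) + (LINT x|lebesgue_on \<Omega>. (norm (g x - h x))\<^sup>2))"
proof -
  note wg = has_weak_grad_diff[OF \<Omega> u v]
  have gh: "(\<lambda>x. g x - h x) \<in> borel_measurable (lebesgue_on \<Omega>)" using m by measurable
  have "(LINT x|lebesgue_on \<Omega>. (norm (weak_grad \<Omega> (\<lambda>x. u x - v x) x))\<^sup>2) =
      (LINT x|lebesgue_on \<Omega>. (norm (g x - h x))\<^sup>2)"
  proof (rule integral_cong_AE)
    show "AE x in lebesgue_on \<Omega>. (norm (weak_grad \<Omega> (\<lambda>x. u x - v x) x))\<^sup>2 = (norm (g x - h x))\<^sup>2"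
      using weak_grad_AE_eq[OF \<Omega> wg] by eventually_elim simp
  qed (use gh weak_grad_measurable[OF \<Omega> wg gh] in measurable)
  then show ?thesis by (simp add: W12_norm_def)
qed

lemma test_function_Lp_2:
  assumes \<Omega>: "open \<Omega>" and \<phi>: "\<phi> \<in> test_functions \<Omega>"
  shows "\<phi> \<in> Lp 2 \<Omega>" and "gradient \<phi> \<in> Lp 2 \<Omega>"
proof -
  obtain K where K: "compact K" "K \<subseteq> \<Omega>" "\<And>x. x \<notin> K \<Longrightarrow> \<phi> x = 0"
    "\<And>x i. x \<notin> K \<Longrightarrow> frechet_derivative \<phi> (at x) i = 0"
    using \<phi> by (rule test_functionD) blast
  have *: "f \<in> Lp 2 \<Omega>" if f: "continuous_on UNIV f" "\<And>x. x \<notin> K \<Longrightarrow> f x = 0" for f :: "_ \<Rightarrow> 'c::euclidean_space"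
  proof -
    have "integrable (lebesgue_on \<Omega>) (\<lambda>x. (norm (f x))\<^sup>2)"
      using f by (intro lebesgue_on_compact_support(1)[OF \<Omega> K(1,2)] continuous_intros)
        (auto intro: continuous_on_subset)
    moreover have "f \<in> borel_measurable (lebesgue_on \<Omega>)"
      using f \<Omega> by (intro continuous_imp_measurable_on_sets_lebesgue) (auto intro: continuous_on_subset)
    ultimately show ?thesis by (simp add: Lp_2_iff)
  qed
  show "\<phi> \<in> Lp 2 \<Omega>" by (intro * test_function_derivative(3)[OF \<phi>] K)
  show "gradient \<phi> \<in> Lp 2 \<Omega>"
    by (intro * continuous_on_gradient[OF \<phi>]) (simp add: gradient_def K)
qed

lemma W12D:
  assumes "u \<in> W12 \<Omega>"
  shows "u \<in> Lp 2 \<Omega>" "weak_grad \<Omega> u \<in> Lp 2 \<Omega>" "has_weak_grad \<Omega> u (weak_grad \<Omega> u)"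
  using assms has_weak_grad_weak_grad by (auto simp: W12_def)

lemma W12I:
  assumes \<Omega>: "open \<Omega>" and u: "u \<in> Lp 2 \<Omega>" "has_weak_grad \<Omega> u g" "g \<in> Lp 2 \<Omega>"
  shows "u \<in> W12 \<Omega>"
proof -
  have "g \<in> borel_measurable (lebesgue_on \<Omega>)" using u(3) by (simp add: Lp_2_iff)
  then have "weak_grad \<Omega> u \<in> borel_measurable (lebesgue_on \<Omega>)"
    using weak_grad_measurable[OF \<Omega> u(2)] by simp
  then have "weak_grad \<Omega> u \<in> Lp 2 \<Omega>"
    by (rule Lp_2_bounded_by[OF _ u(3)])
       (use weak_grad_AE_eq[OF \<Omega> u(2)] in eventually_elim, simp)
  then show ?thesis using u by (auto simp: W12_def)
qed

lemma W12_0I: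
  assumes \<Omega>: "open \<Omega>" and u: "u \<in> Lp 2 \<Omega>" "has_weak_grad \<Omega> u g" "g \<in> Lp 2 \<Omega>"
    and \<phi>: "\<And>k::nat. \<phi> k \<in> test_functions \<Omega>"
      "(\<lambda>k. LINT x|lebesgue_on \<Omega>. (\<phi> k x - u x)\<^sup>2) \<longlonglongrightarrow> 0"
      "(\<lambda>k. LINT x|lebesgue_on \<Omega>. (norm (gradient (\<phi> k) x - g x))\<^sup>2) \<longlonglongrightarrow> 0"
  shows "u \<in> W12_0 \<Omega>"
proof -
  have m: "g \<in> borel_measurable (lebesgue_on \<Omega>)" "gradient (\<phi> k) \<in> borel_measurable (lebesgue_on \<Omega>)" for k
    using u(3) test_function_Lp_2(2)[OF \<Omega> \<phi>(1)] by (simp_all add: Lp_2_iff)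
  have "(\<lambda>k. W12_norm \<Omega> (\<lambda>x. \<phi> k x - u x)) \<longlonglongrightarrow> sqrt (0 + 0)"
    unfolding W12_norm_diff[OF \<Omega> has_weak_grad_test_function[OF \<Omega> \<phi>(1)] u(2) m(2,1)]
    by (intro tendsto_intros \<phi>)
  then show ?thesis using W12I[OF \<Omega> u] \<phi>(1) by (auto simp: W12_0_def)
qed

lemma W12_0_approx:
  assumes \<Omega>: "open \<Omega>" "finite_measure (lebesgue_on \<Omega>)" and u: "u \<in> W12_0 \<Omega>"
  obtains \<phi> where "\<And>k::nat. \<phi> k \<in> test_functions \<Omega>"
    "(\<lambda>k. LINT x|lebesgue_on \<Omega>. \<bar>\<phi> k x - u x\<bar>) \<longlonglongrightarrow> 0"
    "(\<lambda>k. LINT x|lebesgue_on \<Omega>. norm (gradient (\<phi> k) x - weak_grad \<Omega> u x)) \<longlonglongrightarrow> 0"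
proof -
  have uW: "u \<in> W12 \<Omega>" using u by (simp add: W12_0_def)
  obtain \<phi> where \<phi>: "\<And>k::nat. \<phi> k \<in> test_functions \<Omega>"
    and lim: "(\<lambda>k. W12_norm \<Omega> (\<lambda>x. \<phi> k x - u x)) \<longlonglongrightarrow> 0"
    using u by (auto simp: W12_0_def)
  note tf = test_function_Lp_2[OF \<Omega>(1) \<phi>]
  have d: "(\<lambda>x. \<phi> k x - u x) \<in> Lp 2 \<Omega>" "(\<lambda>x. gradient (\<phi> k) x - weak_grad \<Omega> u x) \<in> Lp 2 \<Omega>" for k
    using tf W12D[OF uW] by (auto intro: Lp_2_diff)
  have m: "weak_grad \<Omega> u \<in> borel_measurable (lebesgue_on \<Omega>)" "gradient (\<phi> k) \<in> borel_measurable (lebesgue_on \<Omega>)" for k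
    using W12D(2)[OF uW] tf(2) by (simp_all add: Lp_2_iff)
  define A where "A = (\<lambda>k. LINT x|lebesgue_on \<Omega>. (norm (\<phi> k x - u x))\<^sup>2)"
  define B where "B = (\<lambda>k. LINT x|lebesgue_on \<Omega>. (norm (gradient (\<phi> k) x - weak_grad \<Omega> u x))\<^sup>2)"
  define V where "V = measure (lebesgue_on \<Omega>) (space (lebesgue_on \<Omega>)) + 1"
  have N: "W12_norm \<Omega> (\<lambda>x. \<phi> k x - u x) = sqrt (A k + B k)" for k
    unfolding W12_norm_diff[OF \<Omega>(1) has_weak_grad_test_function[OF \<Omega>(1) \<phi>] W12D(3)[OF uW] m(2,1)]
    by (simp add: A_def B_def)
  have nn: "A k \<ge> 0" "B k \<ge> 0" for k by (simp_all add: A_def B_def)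
  have AB: "(\<lambda>k. A k + B k) \<longlonglongrightarrow> 0"
    using tendsto_power[OF lim, of 2] nn by (simp add: N)
  have A: "A \<longlonglongrightarrow> 0" and B: "B \<longlonglongrightarrow> 0"
    by (rule tendsto_sandwich[OF _ _ tendsto_const AB]; simp add: nn)+
  have L: "(\<lambda>k. sqrt (A k * V)) \<longlonglongrightarrow> 0" "(\<lambda>k. sqrt (B k * V)) \<longlonglongrightarrow> 0"
    using tendsto_real_sqrt[OF tendsto_mult_left_zero[OF A, of V]]
      tendsto_real_sqrt[OF tendsto_mult_left_zero[OF B, of V]] by simp_all
  have "(LINT x|lebesgue_on \<Omega>. \<bar>\<phi> k x - u x\<bar>) \<le> sqrt (A k * V)"
    "(LINT x|lebesgue_on \<Omega>. norm (gradient (\<phi> k) x - weak_grad \<Omega> u x)) \<le> sqrt (B k * V)" for k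
    using integral_le_L2(2)[OF \<Omega>(2) d(1)[of k]] integral_le_L2(2)[OF \<Omega>(2) d(2)[of k]]
    by (simp_all add: A_def B_def V_def)
  then have "(\<lambda>k. LINT x|lebesgue_on \<Omega>. \<bar>\<phi> k x - u x\<bar>) \<longlonglongrightarrow> 0"
    "(\<lambda>k. LINT x|lebesgue_on \<Omega>. norm (gradient (\<phi> k) x - weak_grad \<Omega> u x)) \<longlonglongrightarrow> 0"
    using tendsto_sandwich[OF _ _ tendsto_const L(1)] tendsto_sandwich[OF _ _ tendsto_const L(2)] by simp_all
  then show thesis using that \<phi> by blast
qed

lemma tendsto_integral_bounded_inner:
  fixes f :: "'a::euclidean_space \<Rightarrow> 'b::euclidean_space"
  assumes "\<And>k. integrable M (\<lambda>x. F k x \<bullet> f x)" "integrable M (\<lambda>x. F' x \<bullet> f x)"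
    and "\<And>k. integrable M (\<lambda>x. norm (F k x - F' x))"
    and "\<And>x. x \<in> space M \<Longrightarrow> norm (f x) \<le> C"
    and lim: "(\<lambda>k. LINT x|M. norm (F k x - F' x)) \<longlonglongrightarrow> 0"
  shows "(\<lambda>k::nat. LINT x|M. F k x \<bullet> f x) \<longlonglongrightarrow> (LINT x|M. F' x \<bullet> f x)"
proof (rule LIM_zero_cancel, rule Lim_null_comparison)
  show "(\<lambda>k. (LINT x|M. norm (F k x - F' x)) * C) \<longlonglongrightarrow> 0"
    by (rule tendsto_mult_left_zero[OF lim])
  have "norm ((LINT x|M. F k x \<bullet> f x) - (LINT x|M. F' x \<bullet> f x)) \<le> (LINT x|M. norm (F k x - F' x)) * C" for k
  proof -
    have "norm ((LINT x|M. F k x \<bullet> f x) - (LINT x|M. F' x \<bullet> f x)) =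
      norm (LINT x|M. (F k x - F' x) \<bullet> f x)" using assms(1,2) by (simp add: inner_diff_left)
    also have "\<dots> \<le> (LINT x|M. norm (F k x - F' x) * C)"
    proof (rule Bochner_Integration.integral_norm_bound_integral)
      show "integrable M (\<lambda>x. (F k x - F' x) \<bullet> f x)" using assms(1,2) by (simp add: inner_diff_left)
      fix x assume "x \<in> space M"
      then have "norm (F k x - F' x) * norm (f x) \<le> norm (F k x - F' x) * C"
        using assms(4) by (intro mult_left_mono) auto
      then show "norm ((F k x - F' x) \<bullet> f x) \<le> norm (F k x - F' x) * C"
        using Cauchy_Schwarz_ineq2[of "F k x - F' x" "f x"] by simp
    qed (use assms(3) in simp)
    finally show ?thesis by simp
  qed
  then show "\<forall>\<^sub>F k in sequentially. norm ((LINT x|M. F k x \<bullet> f x) - (LINT x|M. F' x \<bullet> f x)) \<le>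
      (LINT x|M. norm (F k x - F' x)) * C" by simp
qed

lemma integrable_Lp_2_bounded_inner:
  fixes F f :: "'a::euclidean_space \<Rightarrow> 'b::euclidean_space"
  assumes \<Omega>: "finite_measure (lebesgue_on \<Omega>)" and F: "F \<in> Lp 2 \<Omega>"
    and f: "f \<in> borel_measurable (lebesgue_on \<Omega>)" "\<And>x. x \<in> \<Omega> \<Longrightarrow> norm (f x) \<le> C"
  shows "integrable (lebesgue_on \<Omega>) (\<lambda>x. F x \<bullet> f x)"
proof (rule Bochner_Integration.integrable_bound)
  show "integrable (lebesgue_on \<Omega>) (\<lambda>x. norm (F x) * C)"
    using integral_le_L2(1)[OF \<Omega> F] by simp
  show "(\<lambda>x. F x \<bullet> f x) \<in> borel_measurable (lebesgue_on \<Omega>)"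
    using F f by (auto simp: Lp_2_iff)
  show "AE x in lebesgue_on \<Omega>. norm (F x \<bullet> f x) \<le> norm (norm (F x) * C)"
  proof (rule AE_I2)
    fix x assume "x \<in> space (lebesgue_on \<Omega>)"
    then have "norm (F x) * norm (f x) \<le> norm (F x) * C"
      using f(2) by (intro mult_left_mono) auto
    then show "norm (F x \<bullet> f x) \<le> norm (norm (F x) * C)"
      using Cauchy_Schwarz_ineq2[of "F x" "f x"] by simp
  qed
qed

text \<open>Stated for vector fields with bounded divergence, so that \<open>L\<^sup>1\<close> convergence of the test functions
  and their gradients suffices.\<close>

lemma W12_0_integration_by_parts:
  fixes X :: "'a::euclidean_space \<Rightarrow> 'a"
  assumes \<Omega>: "open \<Omega>" "finite_measure (lebesgue_on \<Omega>)" and \<phi>: "\<phi> \<in> W12_0 \<Omega>"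
    and X: "\<And>x i. x \<in> \<Omega> \<Longrightarrow> i \<in> Basis \<Longrightarrow> ((\<lambda>x. X x \<bullet> i) has_derivative X' i x) (at x)"
      "\<And>i. i \<in> Basis \<Longrightarrow> continuous_on \<Omega> (\<lambda>x. X' i x i)"
    and bound: "\<And>x. x \<in> \<Omega> \<Longrightarrow> norm (X x) \<le> C" "\<And>x. x \<in> \<Omega> \<Longrightarrow> \<bar>\<Sum>i\<in>Basis. X' i x i\<bar> \<le> C"
  shows "(LINT x|lebesgue_on \<Omega>. X x \<bullet> weak_grad \<Omega> \<phi> x) =
         - (LINT x|lebesgue_on \<Omega>. (\<Sum>i\<in>Basis. X' i x i) * \<phi> x)"
proof -
  have \<phi>W: "\<phi> \<in> W12 \<Omega>" using \<phi> by (simp add: W12_0_def)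
  obtain \<psi> where \<psi>: "\<And>k::nat. \<psi> k \<in> test_functions \<Omega>"
    "(\<lambda>k. LINT x|lebesgue_on \<Omega>. \<bar>\<psi> k x - \<phi> x\<bar>) \<longlonglongrightarrow> 0"
    "(\<lambda>k. LINT x|lebesgue_on \<Omega>. norm (gradient (\<psi> k) x - weak_grad \<Omega> \<phi> x)) \<longlonglongrightarrow> 0"
    using W12_0_approx[OF \<Omega> \<phi>] by blast
  note tf = test_function_Lp_2[OF \<Omega>(1) \<psi>(1)]
  have cXi: "continuous_on \<Omega> (\<lambda>x. X x \<bullet> i)" if "i \<in> Basis" for i
    using X(1)[OF _ that] has_derivative_continuous by (blast intro: continuous_at_imp_continuous_on)
  have "continuous_on \<Omega> X"
    using cXi by (subst continuous_on_componentwise) blast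
  then have mX: "X \<in> borel_measurable (lebesgue_on \<Omega>)"
    using \<Omega>(1) by (intro continuous_imp_measurable_on_sets_lebesgue) auto
  define D where "D = (\<lambda>x. \<Sum>i\<in>Basis. X' i x i)"
  have mD: "D \<in> borel_measurable (lebesgue_on \<Omega>)"
    unfolding D_def using \<Omega>(1) X(2)
    by (intro continuous_imp_measurable_on_sets_lebesgue continuous_intros) auto
  have 1: "(\<lambda>k. LINT x|lebesgue_on \<Omega>. gradient (\<psi> k) x \<bullet> X x) \<longlonglongrightarrow> (LINT x|lebesgue_on \<Omega>. weak_grad \<Omega> \<phi> x \<bullet> X x)"
  proof (rule tendsto_integral_bounded_inner[OF _ _ _ _ \<psi>(3)])
    show "integrable (lebesgue_on \<Omega>) (\<lambda>x. norm (gradient (\<psi> k) x - weak_grad \<Omega> \<phi> x))" for k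
      by (intro integral_le_L2(1)[OF \<Omega>(2)] Lp_2_diff tf W12D[OF \<phi>W])
  qed (use bound(1) in \<open>auto intro!: integrable_Lp_2_bounded_inner[OF \<Omega>(2) _ mX] tf W12D[OF \<phi>W]\<close>)
  have 2: "(\<lambda>k. LINT x|lebesgue_on \<Omega>. \<psi> k x \<bullet> D x) \<longlonglongrightarrow> (LINT x|lebesgue_on \<Omega>. \<phi> x \<bullet> D x)"
  proof (rule tendsto_integral_bounded_inner)
    show "integrable (lebesgue_on \<Omega>) (\<lambda>x. norm (\<psi> k x - \<phi> x))" for k
      by (intro integral_le_L2(1)[OF \<Omega>(2)] Lp_2_diff tf W12D[OF \<phi>W])
    show *: "norm (D x) \<le> C" if "x \<in> space (lebesgue_on \<Omega>)" for x using bound(2) that by (simp add: D_def)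
    show "integrable (lebesgue_on \<Omega>) (\<lambda>x. \<psi> k x \<bullet> D x)"
      "integrable (lebesgue_on \<Omega>) (\<lambda>x. \<phi> x \<bullet> D x)" for k
      using integrable_Lp_2_bounded_inner[OF \<Omega>(2) tf(1)[of k] mD, of C]
        integrable_Lp_2_bounded_inner[OF \<Omega>(2) W12D(1)[OF \<phi>W] mD, of C] *
      by simp_all
  qed (use \<psi>(2) in simp)
  have 3: "(LINT x|lebesgue_on \<Omega>. gradient (\<psi> k) x \<bullet> X x) = - (LINT x|lebesgue_on \<Omega>. \<psi> k x \<bullet> D x)" for k
  proof -
    have i1: "integrable (lebesgue_on \<Omega>) (\<lambda>x. (X x \<bullet> i) * frechet_derivative (\<psi> k) (at x) i)" if "i \<in> Basis" for i
      by (intro L1_loc_mult_test_function(2)[OF \<Omega>(1) _ \<psi>(1) that] continuous_imp_L1_loc cXi that)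
    have i2: "integrable (lebesgue_on \<Omega>) (\<lambda>x. X' i x i * \<psi> k x)" if "i \<in> Basis" for i
      by (intro L1_loc_mult_test_function(1)[OF \<Omega>(1) _ \<psi>(1)] continuous_imp_L1_loc X(2) that)
    have "(LINT x|lebesgue_on \<Omega>. gradient (\<psi> k) x \<bullet> X x) =
        (LINT x|lebesgue_on \<Omega>. (\<Sum>i\<in>Basis. (X x \<bullet> i) * frechet_derivative (\<psi> k) (at x) i))"
      by (rule Bochner_Integration.integral_cong[OF refl])
         (subst euclidean_inner, simp add: inner_gradient mult.commute)
    also have "\<dots> = (\<Sum>i\<in>Basis. LINT x|lebesgue_on \<Omega>. (X x \<bullet> i) * frechet_derivative (\<psi> k) (at x) i)"
      by (rule Bochner_Integration.integral_sum[OF i1])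
    also have "\<dots> = (\<Sum>i\<in>Basis. - (LINT x|lebesgue_on \<Omega>. X' i x i * \<psi> k x))"
      by (intro sum.cong refl integration_by_parts_test_function[OF \<Omega>(1) \<psi>(1)] X)
    also have "\<dots> = - (LINT x|lebesgue_on \<Omega>. (\<Sum>i\<in>Basis. X' i x i * \<psi> k x))"
      by (simp add: sum_negf Bochner_Integration.integral_sum[OF i2])
    also have "\<dots> = - (LINT x|lebesgue_on \<Omega>. \<psi> k x \<bullet> D x)"
      by (simp add: D_def sum_distrib_left mult.commute)
    finally show ?thesis .
  qed
  have "(LINT x|lebesgue_on \<Omega>. weak_grad \<Omega> \<phi> x \<bullet> X x) = - (LINT x|lebesgue_on \<Omega>. \<phi> x \<bullet> D x)"
    using LIMSEQ_unique[OF 1[unfolded 3] tendsto_minus[OF 2]] .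
  then show ?thesis by (simp add: D_def inner_commute mult.commute)
qed

subsection \<open>The regularised logarithmic profile\<close>

text \<open>\<open>log_weight\<close> is the derivative of \<open>s \<mapsto> 1 / (4 - ln s)\<close>. The constant 4 keeps the logarithm
  away from the pole for \<open>s \<le> 2\<close> and makes the weight decreasing there.\<close>

definition log_weight :: "real \<Rightarrow> real" where
  "log_weight s = 1 / (s * (4 - ln s)\<^sup>2)"

definition log_weight_deriv :: "real \<Rightarrow> real" where
  "log_weight_deriv s = - ((2 - ln s) / (s\<^sup>2 * (4 - ln s) ^ 3))"

lemma log_weight_nonneg: "0 \<le> s \<Longrightarrow> 0 \<le> log_weight s"
  by (simp add: log_weight_def)

lemma ln_le_1: "0 < s \<Longrightarrow> s \<le> 2 \<Longrightarrow> ln s \<le> (1::real)"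
  using ln_le_minus_one[of s] by simp

lemma has_derivative_log_weight:
  assumes "0 < s" "s \<le> 2"
  shows "(log_weight has_real_derivative log_weight_deriv s) (at s)"
proof -
  have L: "4 - ln s > 0" using ln_le_1[OF assms] by simp
  have "((\<lambda>s. 1 / (s * (4 - ln s)\<^sup>2)) has_real_derivative
      - ((4 - ln s)\<^sup>2 - 2 * (4 - ln s)) / (s * (4 - ln s)\<^sup>2)\<^sup>2) (at s)"
    using assms L by (auto intro!: derivative_eq_intros simp: power2_eq_square)
  moreover have "- ((4 - ln s)\<^sup>2 - 2 * (4 - ln s)) / (s * (4 - ln s)\<^sup>2)\<^sup>2 = log_weight_deriv s"
  proof -
    have "(4 - ln s)\<^sup>2 - 2 * (4 - ln s) = (2 - ln s) * (4 - ln s)"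
      by (simp add: power2_eq_square algebra_simps)
    moreover have "(s * (4 - ln s)\<^sup>2)\<^sup>2 = (s\<^sup>2 * (4 - ln s) ^ 3) * (4 - ln s)"
      by (simp add: power2_eq_square power3_eq_cube algebra_simps)
    ultimately show ?thesis using L by (simp add: log_weight_deriv_def)
  qed
  ultimately show ?thesis unfolding log_weight_def[abs_def] by simp
qed

lemma log_weight_deriv_bounds:
  assumes "0 < s" "s \<le> 2"
  shows "log_weight_deriv s \<le> 0" "- (s * log_weight_deriv s) \<le> log_weight s"
proof -
  have L: "4 - ln s > 0" "2 - ln s > 0" using ln_le_1[OF assms] by simp_all
  then show "log_weight_deriv s \<le> 0" using assms by (simp add: log_weight_deriv_def)
  have "- (s * log_weight_deriv s) = log_weight s * ((2 - ln s) / (4 - ln s))"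
    using assms by (simp add: log_weight_deriv_def log_weight_def power2_eq_square power3_eq_cube)
  also have "\<dots> \<le> log_weight s * 1"
    using L assms by (intro mult_left_mono log_weight_nonneg) auto
  finally show "- (s * log_weight_deriv s) \<le> log_weight s" by simp
qed

lemma log_weight_antimono:
  assumes "0 < s" "s \<le> t" "t \<le> 2"
  shows "log_weight t \<le> log_weight s"
proof (rule DERIV_nonpos_imp_nonincreasing[OF assms(2)])
  fix x assume "s \<le> x" "x \<le> t"
  then show "\<exists>y. (log_weight has_real_derivative y) (at x) \<and> y \<le> 0"
    using has_derivative_log_weight[of x] log_weight_deriv_bounds(1)[of x] assms by auto
qed

lemma mult_log_weight_le_1:
  assumes "0 < s" "s \<le> 2"
  shows "s * log_weight s \<le> 1"
proof -
  have "1 \<le> (4 - ln s)\<^sup>2" using ln_le_1[OF assms] by (intro one_le_power) simp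
  then have "1 / (4 - ln s)\<^sup>2 \<le> 1" by (simp add: divide_le_eq)
  then show ?thesis using assms by (simp add: log_weight_def)
qed

definition profile :: "real \<Rightarrow> 'a::euclidean_space \<Rightarrow> real" where
  "profile d x = 1 / 4 - 1 / (4 - ln (x \<bullet> x + d))"

definition profile_grad :: "real \<Rightarrow> 'a::euclidean_space \<Rightarrow> 'a" where
  "profile_grad d x = - (2 * log_weight (x \<bullet> x + d)) *\<^sub>R x"

definition profile_lap :: "real \<Rightarrow> 'a::euclidean_space \<Rightarrow> real" where
  "profile_lap d x = - (2 * real DIM('a) * log_weight (x \<bullet> x + d) + 4 * (x \<bullet> x) * log_weight_deriv (x \<bullet> x + d))"

lemma profile_has_derivative:
  fixes x :: "'a::euclidean_space"
  assumes "0 < x \<bullet> x + d" "x \<bullet> x + d \<le> 2"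
  shows "(profile d has_derivative (\<lambda>h. profile_grad d x \<bullet> h)) (at x)"
proof -
  have L: "4 - ln (x \<bullet> x + d) \<noteq> 0" using ln_le_1[OF assms] by simp
  have "((\<lambda>s. 1 / 4 - 1 / (4 - ln s)) has_real_derivative - log_weight (x \<bullet> x + d)) (at (x \<bullet> x + d))"
    using assms L by (auto intro!: derivative_eq_intros simp: log_weight_def power2_eq_square)
  then have 1: "((\<lambda>s. 1 / 4 - 1 / (4 - ln s)) has_derivative (\<lambda>h. - log_weight (x \<bullet> x + d) * h)) (at (x \<bullet> x + d))"
    unfolding has_field_derivative_def .
  have 2: "((\<lambda>x. x \<bullet> x + d) has_derivative (\<lambda>h. 2 * (x \<bullet> h))) (at x)"
    by (auto intro!: derivative_eq_intros simp: inner_commute)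
  show ?thesis
    using has_derivative_compose[OF 2 1] by (simp add: profile_def[abs_def] profile_grad_def mult.assoc mult.left_commute)
qed

lemma profile_grad_has_derivative:
  fixes x :: "'a::euclidean_space"
  assumes "0 < x \<bullet> x + d" "x \<bullet> x + d \<le> 2"
  shows "((\<lambda>x. profile_grad d x \<bullet> i) has_derivative
    (\<lambda>h. - 2 * (log_weight (x \<bullet> x + d) * (h \<bullet> i) + log_weight_deriv (x \<bullet> x + d) * (2 * (x \<bullet> h)) * (x \<bullet> i)))) (at x)"
proof -
  have 1: "(log_weight has_derivative (\<lambda>h. log_weight_deriv (x \<bullet> x + d) * h)) (at (x \<bullet> x + d))"
    using has_derivative_log_weight[OF assms] by (simp add: has_field_derivative_def)
  have 2: "((\<lambda>x. x \<bullet> x + d) has_derivative (\<lambda>h. 2 * (x \<bullet> h))) (at x)"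
    by (auto intro!: derivative_eq_intros simp: inner_commute)
  have 3: "((\<lambda>x. log_weight (x \<bullet> x + d)) has_derivative (\<lambda>h. log_weight_deriv (x \<bullet> x + d) * (2 * (x \<bullet> h)))) (at x)"
    by (rule has_derivative_compose[OF 2 1])
  have 4: "((\<lambda>x. x \<bullet> i) has_derivative (\<lambda>h. h \<bullet> i)) (at x)" by (auto intro!: derivative_eq_intros)
  have "(\<lambda>x. profile_grad d x \<bullet> i) = (\<lambda>x. - 2 * (log_weight (x \<bullet> x + d) * (x \<bullet> i)))"
    by (simp add: profile_grad_def mult.assoc)
  then show ?thesis using has_derivative_mult_right[OF has_derivative_mult[OF 3 4], of "- 2"] by simp
qed

lemma sum_profile_grad_derivative:
  fixes x :: "'a::euclidean_space"
  shows "(\<Sum>i\<in>Basis. - 2 * (log_weight (x \<bullet> x + d) * (i \<bullet> i) +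
    log_weight_deriv (x \<bullet> x + d) * (2 * (x \<bullet> i)) * (x \<bullet> i))) = profile_lap d x"
proof -
  have "(\<Sum>i\<in>Basis. - 2 * (log_weight (x \<bullet> x + d) * (i \<bullet> i) +
      log_weight_deriv (x \<bullet> x + d) * (2 * (x \<bullet> i)) * (x \<bullet> i))) =
    (\<Sum>i\<in>(Basis::'a set). - 2 * log_weight (x \<bullet> x + d) - 4 * log_weight_deriv (x \<bullet> x + d) * ((x \<bullet> i) * (x \<bullet> i)))"
    by (intro sum.cong) (simp_all add: algebra_simps)
  also have "\<dots> = - 2 * real DIM('a) * log_weight (x \<bullet> x + d) -
      4 * log_weight_deriv (x \<bullet> x + d) * (\<Sum>i\<in>Basis. (x \<bullet> i) * (x \<bullet> i))"
    by (simp add: sum_subtractf sum_distrib_left)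
  also have "\<dots> = profile_lap d x"
    unfolding euclidean_inner[of x x, symmetric] by (simp add: profile_lap_def)
  finally show ?thesis .
qed

lemma inner_self_less_1: "x \<in> ball 0 1 \<Longrightarrow> x \<bullet> x < 1"
  by (simp add: dot_square_norm abs_square_less_1)

lemma profile_bounds:
  fixes x :: "'a::euclidean_space"
  assumes "0 < x \<bullet> x + d" "x \<bullet> x + d \<le> 2" "0 \<le> d"
  shows "\<bar>profile d x\<bar> \<le> 1 / 4"
    and "(norm (profile_grad d x))\<^sup>2 \<le> 4 * log_weight (x \<bullet> x + d)"
    and "\<bar>profile_lap d x\<bar> \<le> (2 * real DIM('a) + 4) * log_weight (x \<bullet> x + d)"
proof -
  let ?s = "x \<bullet> x + d"
  have L: "4 - ln ?s \<ge> 3" using ln_le_1[OF assms(1,2)] by simp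
  then have "0 \<le> 1 / (4 - ln ?s)" "1 / (4 - ln ?s) \<le> 1 / 3" by (simp_all add: field_simps)
  then show "\<bar>profile d x\<bar> \<le> 1 / 4" unfolding profile_def by linarith
  have q: "0 \<le> log_weight ?s" using assms by (simp add: log_weight_nonneg)
  have "(norm (profile_grad d x))\<^sup>2 = 4 * log_weight ?s * ((x \<bullet> x) * log_weight ?s)"
    by (simp add: profile_grad_def power_mult_distrib dot_square_norm power2_eq_square)
  also have "\<dots> \<le> 4 * log_weight ?s * (?s * log_weight ?s)"
    using q assms by (intro mult_left_mono mult_right_mono) auto
  also have "\<dots> \<le> 4 * log_weight ?s * 1"
    using q mult_log_weight_le_1[OF assms(1,2)] by (intro mult_left_mono) auto
  finally show "(norm (profile_grad d x))\<^sup>2 \<le> 4 * log_weight ?s" by simp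
  have "- ((x \<bullet> x) * log_weight_deriv ?s) \<le> - (?s * log_weight_deriv ?s)"
    using log_weight_deriv_bounds(1)[OF assms(1,2)] assms(3) by (simp add: mult_right_mono_neg)
  also have "\<dots> \<le> log_weight ?s" by (rule log_weight_deriv_bounds(2)[OF assms(1,2)])
  finally have 1: "- ((x \<bullet> x) * log_weight_deriv ?s) \<le> log_weight ?s" .
  have 2: "(x \<bullet> x) * log_weight_deriv ?s \<le> 0"
    using log_weight_deriv_bounds(1)[OF assms(1,2)] by (simp add: mult_nonneg_nonpos)
  have 3: "0 \<le> 2 * real DIM('a) * log_weight ?s" using q by simp
  have "profile_lap d x = - (2 * real DIM('a) * log_weight ?s) - 4 * ((x \<bullet> x) * log_weight_deriv ?s)"
    by (simp add: profile_lap_def)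
  then show "\<bar>profile_lap d x\<bar> \<le> (2 * real DIM('a) + 4) * log_weight ?s"
    unfolding distrib_right using 1 2 3 q by (simp only: abs_le_iff) linarith
qed

lemma profile_weight_bounds:
  fixes x :: "'a::euclidean_space"
  assumes "x \<in> ball 0 1" "0 \<le> d" "d \<le> 1"
  shows "(norm (profile_grad d x))\<^sup>2 \<le> 4 * log_weight (x \<bullet> x)"
    and "x \<noteq> 0 \<Longrightarrow> \<bar>profile_lap d x\<bar> \<le> (2 * real DIM('a) + 4) * log_weight (x \<bullet> x)"
    and "x \<noteq> 0 \<Longrightarrow> \<bar>profile d x\<bar> \<le> 1 / 4"
proof -
  have *: "0 < x \<bullet> x + d" "x \<bullet> x + d \<le> 2" "log_weight (x \<bullet> x + d) \<le> log_weight (x \<bullet> x)" if "x \<noteq> 0"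
    using that assms inner_self_less_1[OF assms(1)]
    by (auto intro!: log_weight_antimono add_pos_nonneg)
  show "(norm (profile_grad d x))\<^sup>2 \<le> 4 * log_weight (x \<bullet> x)"
  proof (cases "x = 0")
    case False
    then show ?thesis using profile_bounds(2)[OF *(1,2) assms(2)] *(3) by linarith
  qed (simp add: profile_grad_def log_weight_def)
  show "\<bar>profile_lap d x\<bar> \<le> (2 * real DIM('a) + 4) * log_weight (x \<bullet> x)" if "x \<noteq> 0"
    using profile_bounds(3)[OF *(1,2)[OF that] assms(2)] mult_left_mono[OF *(3)[OF that], of "2 * real DIM('a) + 4"]
    by linarith
  show "\<bar>profile d x\<bar> \<le> 1 / 4" if "x \<noteq> 0"
    using profile_bounds(1)[OF *(1,2)[OF that] assms(2)] .
qed

lemma profile_lap_nonpos: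
  fixes x :: "'a::euclidean_space"
  assumes "x \<in> ball 0 1" "DIM('a) \<ge> 2"
  shows "profile_lap 0 x \<le> 0"
proof (cases "x = 0")
  case False
  then have x: "0 < x \<bullet> x" "x \<bullet> x \<le> 2" using inner_self_less_1[OF assms(1)] by auto
  have "4 * log_weight (x \<bullet> x) \<le> 2 * real DIM('a) * log_weight (x \<bullet> x)"
    using assms(2) x by (intro mult_right_mono log_weight_nonneg) auto
  then show ?thesis using log_weight_deriv_bounds(2)[OF x] by (simp add: profile_lap_def)
qed (simp add: profile_lap_def log_weight_def)

lemma borel_measurable_profile [measurable]:
  "log_weight \<in> borel_measurable borel" "log_weight_deriv \<in> borel_measurable borel"
  "profile d \<in> borel_measurable borel" "profile_grad d \<in> borel_measurable borel"
  "profile_lap d \<in> borel_measurable borel"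
proof -
  show 1[measurable]: "log_weight \<in> borel_measurable borel"
    unfolding log_weight_def[abs_def] by measurable
  show 2[measurable]: "log_weight_deriv \<in> borel_measurable borel"
    unfolding log_weight_deriv_def[abs_def] by measurable
  show "profile d \<in> borel_measurable borel" unfolding profile_def[abs_def] by measurable
  show "profile_grad d \<in> borel_measurable borel" unfolding profile_grad_def[abs_def] by measurable
  show "profile_lap d \<in> borel_measurable borel" unfolding profile_lap_def[abs_def] by measurable
qed

lemma borel_measurable_lebesgue_onI: "f \<in> borel_measurable borel \<Longrightarrow> f \<in> borel_measurable (lebesgue_on \<Omega>)"
  by (intro measurable_restrict_space1 measurable_completion) simp

text \<open>The dyadic balls \<open>ball 0 (1 / 2 ^ k)\<close> turn the integral into a sum over \<open>k\<close> that is
  comparable to \<open>\<Sum>k. 1 / k ^ N\<close>.\<close>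

lemma log_weight_powr_le_dyadic:
  fixes x :: "'a::euclidean_space"
  assumes x: "x \<in> ball 0 1" "x \<noteq> 0"
  obtains k :: nat where "x \<in> ball 0 (1 / 2 ^ k)"
    "log_weight (x \<bullet> x) powr (real n / 2) \<le> (2 ^ Suc k / real (Suc k)) ^ n"
proof -
  define r where "r = norm x"
  have r: "0 < r" "r < 1" using x by (auto simp: r_def)
  obtain m where m: "(1 / 2) ^ m < r" using real_arch_pow_inv[OF r(1), of "1 / 2"] by auto
  define K where "K = (LEAST m. (1 / 2) ^ m \<le> r)"
  have K: "(1 / 2) ^ K \<le> r" unfolding K_def by (rule LeastI[of _ m]) (use m in simp)
  have "K \<noteq> 0" using K r by (intro notI) simp
  then obtain k where k: "K = Suc k" using not0_implies_Suc by blast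
  have rk: "r < (1 / 2) ^ k"
    using not_less_Least[of k "\<lambda>m. (1 / 2) ^ m \<le> r"] k by (simp add: K_def not_le)
  have "ln r < ln ((1 / 2) ^ k)" using rk r by simp
  also have "\<dots> = - (real k * ln 2)" by (simp add: ln_realpow ln_div)
  finally have "ln r < - (real k * ln 2)" .
  moreover have "real k * (1 / 2) \<le> real k * ln 2"
    using ln2_ge_two_thirds by (intro mult_left_mono) auto
  ultimately have L: "real (Suc k) \<le> 4 - 2 * ln r"
    unfolding of_nat_Suc by linarith
  have "(1 / 2) ^ Suc k * real (Suc k) \<le> r * (4 - 2 * ln r)"
    by (rule mult_mono[OF K[unfolded k] L]) (use r in simp_all)
  then have "1 / (r * (4 - 2 * ln r)) \<le> 1 / ((1 / 2) ^ Suc k * real (Suc k))"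
  proof (rule divide_left_mono)
    have "0 < 4 - 2 * ln r" using L by linarith
    then show "0 < r * (4 - 2 * ln r) * ((1 / 2) ^ Suc k * real (Suc k))"
      using r by (simp del: of_nat_Suc)
  qed simp
  then have le: "1 / (r * (4 - 2 * ln r)) \<le> 2 ^ Suc k / real (Suc k)"
    by (simp add: power_divide del: of_nat_Suc power_Suc)
  have "x \<bullet> x = r\<^sup>2" by (simp add: r_def dot_square_norm)
  then have "log_weight (x \<bullet> x) = (1 / (r * (4 - 2 * ln r)))\<^sup>2"
    using r by (simp add: log_weight_def ln_realpow power_mult_distrib power_divide)
  then have "log_weight (x \<bullet> x) powr (real n / 2) = (1 / (r * (4 - 2 * ln r))) ^ n"
    using r L by (simp add: powr_powr powr_realpow[symmetric] del: powr_numeral)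
  also have "\<dots> \<le> (2 ^ Suc k / real (Suc k)) ^ n"
    using le r L by (intro power_mono) auto
  finally show thesis using that[of k] rk by (simp add: r_def power_divide)
qed

lemma integrable_log_weight_powr:
  assumes N: "DIM('a::euclidean_space) \<ge> 2"
  shows "integrable (lebesgue_on (ball (0::'a) 1)) (\<lambda>x. log_weight (x \<bullet> x) powr (real DIM('a) / 2))"
proof -
  let ?N = "DIM('a)"
  let ?f = "\<lambda>x::'a. log_weight (x \<bullet> x) powr (real ?N / 2)"
  let ?c = "\<lambda>k. (2 ^ Suc k / real (Suc k)) ^ ?N"
  have m: "(\<lambda>x. indicator (ball 0 1) x *\<^sub>R ?f x) \<in> borel_measurable borel"
    by (intro borel_measurable_scaleR borel_measurable_indicator) (simp, measurable)
  have "integrable lborel (\<lambda>x. indicator (ball 0 1) x *\<^sub>R ?f x)"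
  proof (rule integrableI_bounded)
    show "(\<lambda>x. indicator (ball 0 1) x *\<^sub>R ?f x) \<in> borel_measurable lborel" using m by simp
    have le: "ennreal (norm (indicator (ball 0 1) x *\<^sub>R ?f x)) \<le>
        (\<Sum>k. ennreal (?c k) * indicator (ball 0 (1 / 2 ^ k)) x)" for x
    proof (cases "x \<in> ball 0 1 \<and> x \<noteq> 0")
      case True
      then obtain k where k: "x \<in> ball 0 (1 / 2 ^ k)" "?f x \<le> ?c k"
        using log_weight_powr_le_dyadic by metis
      have "ennreal (norm (indicator (ball 0 1) x *\<^sub>R ?f x)) \<le> ennreal (?c k) * indicator (ball 0 (1 / 2 ^ k)) x"
        using True k by (simp add: ennreal_leI del: power_Suc)
      also have "\<dots> \<le> (\<Sum>k. ennreal (?c k) * indicator (ball 0 (1 / 2 ^ k)) x)"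
        (is "?F k \<le> _")
        using sum_le_suminf[of ?F "{k}"] by (simp only: sum.insert_if finite.emptyI) simp
      finally show ?thesis .
    qed (auto simp: log_weight_def)
    have sum: "summable (\<lambda>k. unit_ball_vol ?N * 2 ^ ?N * inverse (real (Suc k) ^ ?N))"
      using inverse_power_summable[OF N, where 'a = real]
      by (intro summable_mult) (subst summable_Suc_iff)
    have ball: "ennreal (?c k) * emeasure lborel (ball (0::'a) (1 / 2 ^ k)) =
        ennreal (unit_ball_vol ?N * 2 ^ ?N * inverse (real (Suc k) ^ ?N))" for k
    proof -
      have "?c k * (unit_ball_vol ?N * (1 / 2 ^ k) ^ ?N) = unit_ball_vol ?N * 2 ^ ?N * inverse (real (Suc k) ^ ?N)"
        by (simp add: power_divide power_mult_distrib field_simps del: of_nat_Suc)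
      then show ?thesis by (simp add: emeasure_ball ennreal_mult[symmetric] del: power_Suc of_nat_Suc)
    qed
    have "(\<integral>\<^sup>+x. ennreal (norm (indicator (ball 0 1) x *\<^sub>R ?f x)) \<partial>lborel) \<le>
        (\<integral>\<^sup>+x. (\<Sum>k. ennreal (?c k) * indicator (ball (0::'a) (1 / 2 ^ k)) x) \<partial>lborel)"
      by (intro nn_integral_mono le)
    also have "\<dots> = (\<Sum>k. ennreal (?c k) * emeasure lborel (ball (0::'a) (1 / 2 ^ k)))"
      by (subst nn_integral_suminf) (auto simp: nn_integral_cmult_indicator intro!: borel_measurable_times_ennreal borel_measurable_indicator)
    also have "\<dots> = ennreal (\<Sum>k. unit_ball_vol ?N * 2 ^ ?N * inverse (real (Suc k) ^ ?N))"
      unfolding ball by (rule suminf_ennreal2[OF _ sum]) simp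
    also have "\<dots> < \<infinity>" by simp
    finally show "(\<integral>\<^sup>+x. ennreal (norm (indicator (ball 0 1) x *\<^sub>R ?f x)) \<partial>lborel) < \<infinity>" .
  qed
  then have "integrable lebesgue (\<lambda>x. indicator (ball 0 1) x *\<^sub>R ?f x)"
    using m by (subst integrable_completion) simp_all
  then show ?thesis by (simp add: integrable_restrict_space del: real_scaleR_def)
qed

lemma finite_measure_ball: "finite_measure (lebesgue_on (ball (0::'a::euclidean_space) 1))"
  by (rule finite_measureI) (simp add: emeasure_restrict_space emeasure_ball)

lemma integrable_log_weight:
  assumes N: "DIM('a::euclidean_space) \<ge> 2"
  shows "integrable (lebesgue_on (ball (0::'a) 1)) (\<lambda>x. log_weight (x \<bullet> x))"
proof (rule Bochner_Integration.integrable_bound)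
  interpret finite_measure "lebesgue_on (ball (0::'a) 1)" by (rule finite_measure_ball)
  show "integrable (lebesgue_on (ball (0::'a) 1)) (\<lambda>x. 1 + log_weight (x \<bullet> x) powr (real DIM('a) / 2))"
    using integrable_log_weight_powr[OF N] by simp
  show "(\<lambda>x. log_weight (x \<bullet> x)) \<in> borel_measurable (lebesgue_on (ball (0::'a) 1))"
    by (intro borel_measurable_lebesgue_onI) measurable
  have "log_weight (x \<bullet> x) \<le> 1 + log_weight (x \<bullet> x) powr (real DIM('a) / 2)" for x :: 'a
  proof (cases "log_weight (x \<bullet> x) \<le> 1")
    case False
    then have "log_weight (x \<bullet> x) powr 1 \<le> log_weight (x \<bullet> x) powr (real DIM('a) / 2)"
      using N by (intro powr_mono) auto
    then show ?thesis using False by simp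
  qed (simp add: add_increasing2)
  then show "AE x in lebesgue_on (ball (0::'a) 1). norm (log_weight (x \<bullet> x)) \<le>
      norm (1 + log_weight (x \<bullet> x) powr (real DIM('a) / 2))"
    by (intro AE_I2) (simp add: log_weight_nonneg)
qed

lemma Lp_bounded_by_log_weight:
  fixes g :: "'a::euclidean_space \<Rightarrow> real"
  assumes N: "DIM('a) \<ge> 2" and g: "g \<in> borel_measurable borel"
    and le: "\<And>x. x \<in> ball 0 1 \<Longrightarrow> x \<noteq> 0 \<Longrightarrow> \<bar>g x\<bar> \<le> C * log_weight (x \<bullet> x)"
    and C: "0 \<le> C" and g0: "g 0 = 0"
  shows "g \<in> Lp (real DIM('a) / 2) (ball 0 1)"
proof -
  have "integrable (lebesgue_on (ball (0::'a) 1)) (\<lambda>x. norm (g x) powr (real DIM('a) / 2))"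
  proof (rule Bochner_Integration.integrable_bound)
    show "integrable (lebesgue_on (ball (0::'a) 1)) (\<lambda>x. C powr (real DIM('a) / 2) * log_weight (x \<bullet> x) powr (real DIM('a) / 2))"
      using integrable_log_weight_powr[OF N] by simp
    show "(\<lambda>x. norm (g x) powr (real DIM('a) / 2)) \<in> borel_measurable (lebesgue_on (ball 0 1))"
      using g by (intro borel_measurable_lebesgue_onI) measurable
    show "AE x in lebesgue_on (ball 0 1). norm (norm (g x) powr (real DIM('a) / 2)) \<le>
        norm (C powr (real DIM('a) / 2) * log_weight (x \<bullet> x) powr (real DIM('a) / 2))"
    proof (rule AE_I2)
      fix x :: 'a assume "x \<in> space (lebesgue_on (ball 0 1))"
      then have "\<bar>g x\<bar> \<le> C * log_weight (x \<bullet> x)" using le[of x] g0 by (cases "x = 0") (auto simp: log_weight_def)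
      then have "\<bar>g x\<bar> powr (real DIM('a) / 2) \<le> (C * log_weight (x \<bullet> x)) powr (real DIM('a) / 2)"
        by (intro powr_mono2) auto
      also have "\<dots> = C powr (real DIM('a) / 2) * log_weight (x \<bullet> x) powr (real DIM('a) / 2)"
        using C by (simp add: powr_mult log_weight_nonneg)
      finally show "norm (norm (g x) powr (real DIM('a) / 2)) \<le>
        norm (C powr (real DIM('a) / 2) * log_weight (x \<bullet> x) powr (real DIM('a) / 2))" by simp
    qed
  qed
  then show ?thesis using borel_measurable_lebesgue_onI[OF g] by (simp add: Lp_def)
qed

subsection \<open>The solution and its approximation by test functions\<close>

text \<open>The case distinction is needed because \<open>ln 0 = 0\<close>.\<close>

definition solution :: "'a::euclidean_space \<Rightarrow> real" where
  "solution x = (if x = 0 then 1 / 4 else profile 0 x)"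

definition eps :: "nat \<Rightarrow> real" where
  "eps n = inverse (real (Suc n))"

text \<open>Multiplying \<open>t\<close> by \<open>exp (- 1 / (m t))\<close> keeps the derivative in \<open>t\<close> between 0 and 1.\<close>

definition cutoff_profile :: "nat \<Rightarrow> 'a::euclidean_space \<Rightarrow> real" where
  "cutoff_profile n x = (if x \<bullet> x + eps n < 2
     then profile (eps n) x * exp_cutoff 1 (real (Suc n) * profile (eps n) x) else 0)"

lemma eps: "0 < eps n" "eps n \<le> 1"
  by (auto simp: eps_def inverse_le_1_iff)

lemma eps_tendsto: "eps \<longlonglongrightarrow> 0"
  using LIMSEQ_inverse_real_of_nat by (simp add: eps_def[abs_def])

lemma AE_ball_nonzero: "AE x in lebesgue_on (ball (0::'a::euclidean_space) 1). x \<in> ball 0 1 \<and> x \<noteq> 0"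
proof -
  have "AE x in lebesgue. x \<noteq> (0::'a)" by (rule AE_completion[OF AE_lborel_singleton])
  then have "AE x in lebesgue. x \<in> ball 0 1 \<longrightarrow> x \<in> ball 0 1 \<and> x \<noteq> (0::'a)"
    by eventually_elim blast
  then show ?thesis by (subst AE_restrict_space_iff) simp_all
qed

lemma borel_measurable_solution [measurable]: "solution \<in> borel_measurable borel"
  unfolding solution_def[abs_def] by measurable

lemma solution_bounds:
  assumes "x \<in> ball 0 1"
  shows "0 \<le> solution x" "solution x \<le> 1 / 4"
proof -
  have "ln (x \<bullet> x) \<le> 0" using inner_self_less_1[OF assms] by (cases "x = 0") auto
  then have "4 - ln (x \<bullet> x) \<ge> 4" by simp
  then have "0 \<le> 1 / (4 - ln (x \<bullet> x))" "1 / (4 - ln (x \<bullet> x)) \<le> 1 / 4" by (simp_all add: field_simps)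
  then show "0 \<le> solution x" "solution x \<le> 1 / 4" by (auto simp: solution_def profile_def)
qed

lemma profile_pos:
  assumes "x \<in> ball 0 1" "x \<noteq> 0"
  shows "profile 0 x > 0"
proof -
  have "ln (x \<bullet> x) < 0" using inner_self_less_1[OF assms(1)] assms(2) by simp
  then have "1 / (4 - ln (x \<bullet> x)) < 1 / 4" by (simp add: divide_less_eq)
  then show ?thesis by (simp add: profile_def)
qed

lemma continuous_on_solution: "continuous_on (ball 0 1) (solution :: 'a::euclidean_space \<Rightarrow> real)"
proof (rule continuous_at_imp_continuous_on, rule ballI)
  fix x :: 'a assume x: "x \<in> ball 0 1"
  show "isCont solution x"
  proof (cases "x = 0")
    case False
    have "isCont (profile 0) x"
      by (rule has_derivative_continuous[OF profile_has_derivative])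
         (use False inner_self_less_1[OF x] in auto)
    moreover have "\<forall>\<^sub>F y in nhds x. profile 0 y = solution y"
      using False by (intro eventually_nhds[THEN iffD2] exI[of _ "- {0}"]) (auto simp: solution_def)
    ultimately show ?thesis by (metis isCont_cong)
  next
    case True
    have "filterlim (\<lambda>x::'a. x \<bullet> x) (at_right 0) (at 0)"
      unfolding filterlim_at
    proof
      have "((\<lambda>x::'a. x \<bullet> x) \<longlongrightarrow> (0::'a) \<bullet> 0) (at 0)" by (intro tendsto_intros)
      then show "((\<lambda>x::'a. x \<bullet> x) \<longlongrightarrow> 0) (at 0)" by simp
    qed (simp add: eventually_at_filter)
    then have "LIM x at (0::'a). ln (x \<bullet> x) :> at_bot" by (rule filterlim_compose[OF ln_at_0])
    then have "LIM x at (0::'a). 4 + - ln (x \<bullet> x) :> at_top"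
      by (intro filterlim_tendsto_add_at_top[OF tendsto_const])
         (simp add: filterlim_uminus_at_top)
    then have "((\<lambda>x::'a. inverse (4 + - ln (x \<bullet> x))) \<longlongrightarrow> 0) (at 0)"
      by (rule tendsto_inverse_0_at_top)
    then have "((\<lambda>x::'a. 1 / 4 - inverse (4 + - ln (x \<bullet> x))) \<longlongrightarrow> 1 / 4 - 0) (at 0)"
      by (intro tendsto_diff tendsto_const)
    then have "((\<lambda>x::'a. profile 0 x) \<longlongrightarrow> 1 / 4) (at 0)"
      by (simp add: profile_def inverse_eq_divide)
    then have "(solution \<longlongrightarrow> 1 / 4) (at (0::'a))"
      by (rule Lim_transform_eventually) (simp add: eventually_at_filter solution_def)
    then show ?thesis by (simp add: True isCont_def solution_def)
  qed
qed

lemma solution_not_holder: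
  assumes \<gamma>: "0 < \<gamma>"
  shows "\<not> holder_continuous_on \<gamma> (ball (0::'a::euclidean_space) 1) solution"
proof
  assume "holder_continuous_on \<gamma> (ball (0::'a) 1) solution"
  then obtain C where C: "\<And>x y. x \<in> ball (0::'a) 1 \<Longrightarrow> y \<in> ball 0 1 \<Longrightarrow> \<bar>solution x - solution y\<bar> \<le> C * dist x y powr \<gamma>"
    unfolding holder_continuous_on_def by blast
  obtain e :: 'a where e: "e \<in> Basis" using nonempty_Basis by blast
  have bound: "exp (\<gamma> * k) \<le> C * (4 + 2 * k)" if k: "k > 0" for k
  proof -
    define x where "x = exp (- k) *\<^sub>R e"
    have nx: "norm x = exp (- k)" using e by (simp add: x_def)
    then have x: "x \<in> ball 0 1" "x \<noteq> 0" using k by auto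
    have "ln (x \<bullet> x) = - 2 * k" by (simp add: dot_square_norm nx ln_realpow)
    then have "solution (0::'a) - solution x = 1 / (4 + 2 * k)" using x by (simp add: solution_def profile_def)
    moreover have "dist 0 x powr \<gamma> = exp (- (\<gamma> * k))" by (simp add: nx powr_def)
    moreover have "\<bar>solution (0::'a) - solution x\<bar> \<le> C * dist 0 x powr \<gamma>"
      by (intro C x(1)) simp
    then have "solution (0::'a) - solution x \<le> C * dist 0 x powr \<gamma>" by linarith
    ultimately have "1 / (4 + 2 * k) \<le> C * exp (- (\<gamma> * k))" by (simp only:)
    then show ?thesis using k by (simp add: exp_minus field_simps)
  qed
  define k where "k = 2 + 16 * (\<bar>C\<bar> + 1) / \<gamma>\<^sup>2"
  have k: "k \<ge> 2" using \<gamma> by (simp add: k_def)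
  have "\<gamma> * k / 2 \<le> exp (\<gamma> * k / 2)"
    using exp_ge_add_one_self[of "\<gamma> * k / 2"] by linarith
  then have "(\<gamma> * k / 2)\<^sup>2 \<le> (exp (\<gamma> * k / 2))\<^sup>2"
    using \<gamma> k by (intro power_mono) auto
  also have "\<dots> = exp (\<gamma> * k)" by (simp add: power2_eq_square exp_add[symmetric])
  also have "\<dots> \<le> C * (4 + 2 * k)" using k by (intro bound) simp
  also have "\<dots> \<le> \<bar>C\<bar> * (4 * k)" using k by (intro mult_mono) auto
  finally have "\<gamma>\<^sup>2 * k * k \<le> 16 * \<bar>C\<bar> * k" by (simp add: power2_eq_square field_simps)
  then have "\<gamma>\<^sup>2 * k \<le> 16 * \<bar>C\<bar>" using k by simp
  moreover have "\<gamma>\<^sup>2 * k = 2 * \<gamma>\<^sup>2 + 16 * (\<bar>C\<bar> + 1)" using \<gamma> by (simp add: k_def field_simps)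
  ultimately show False using zero_le_power2[of \<gamma>] by (simp add: distrib_left)
qed

lemma cutoff_profile_test_function: "cutoff_profile n \<in> test_functions (ball (0::'a::euclidean_space) 1)"
proof -
  let ?\<chi> = "\<lambda>t. t * exp_cutoff 1 (real (Suc n) * t)"
  let ?S = "{x::'a. x \<bullet> x + eps n < 2}" and ?T = "{x::'a. x \<bullet> x + eps n > 1}"
  have op: "open ?S" "open ?T" by (auto intro!: open_Collect_less continuous_intros)
  have pos: "x \<bullet> x + eps n > 0" for x :: 'a using eps(1)[of n] by (simp add: add_nonneg_pos)
  have neg: "profile (eps n) x \<le> 0" if "x \<bullet> x + eps n \<ge> 1" "x \<bullet> x + eps n < 2" for x :: 'a
  proof -
    have "0 \<le> ln (x \<bullet> x + eps n)" "ln (x \<bullet> x + eps n) \<le> 1"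
      using that ln_le_1[OF pos] by auto
    then have "1 / 4 \<le> 1 / (4 - ln (x \<bullet> x + eps n))" by (simp add: field_simps)
    then show ?thesis by (simp add: profile_def)
  qed
  have zero: "cutoff_profile n x = 0" if "x \<bullet> x + eps n \<ge> 1" for x :: 'a
    using neg[OF that] by (auto simp: cutoff_profile_def exp_cutoff_def zero_less_mult_iff)
  have Ck: "Ck k (cutoff_profile n :: 'a \<Rightarrow> real)" for k
  proof -
    have \<chi>: "Ck_on k UNIV ?\<chi>"
      by (intro Ck_on_mult Ck_on_ident open_UNIV Ck_on_cmult
          Ck_on_compose[OF open_UNIV subset_UNIV _ Ck_on_exp_cutoff])
    have ln: "Ck_on k ?S (\<lambda>x. ln (x \<bullet> x + eps n))"
      by (rule Ck_on_compose[OF op(1) _ _ Ck_on_ln])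
         (use pos in \<open>auto intro!: Ck_on_add Ck_on_inner_self Ck_on_const op\<close>)
    have "Ck_on k ?S (\<lambda>x. inverse (4 - ln (x \<bullet> x + eps n)))"
    proof (rule Ck_on_compose[OF op(1) _ _ Ck_on_inverse])
      show "(\<lambda>x. 4 - ln (x \<bullet> x + eps n)) ` ?S \<subseteq> {0<..}"
      proof (rule image_subsetI)
        fix x :: 'a assume "x \<in> ?S"
        then have "ln (x \<bullet> x + eps n) \<le> 1" by (intro ln_le_1 pos) simp
        then show "4 - ln (x \<bullet> x + eps n) \<in> {0<..}" by simp
      qed
    qed (intro Ck_on_diff Ck_on_const op ln)
    then have "Ck_on k ?S (profile (eps n))"
      unfolding profile_def[abs_def] divide_inverse mult_1_left by (intro Ck_on_diff Ck_on_const op)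
    then have "Ck_on k ?S (\<lambda>x. ?\<chi> (profile (eps n) x))"
      by (rule Ck_on_compose[OF op(1) subset_UNIV _ \<chi>])
    then have "Ck_on k ?S (cutoff_profile n)"
      by (rule Ck_on_cong[OF op(1), rotated]) (simp add: cutoff_profile_def)
    moreover have "Ck_on k ?T (cutoff_profile n)"
      by (rule Ck_on_cong[OF op(2) _ Ck_on_const[OF op(2), of k 0]]) (simp add: zero)
    moreover have "?S \<union> ?T = UNIV" by auto
    ultimately show ?thesis using Ck_on_Un[OF op, of k "cutoff_profile n"] by (simp add: Ck_on_UNIV)
  qed
  have "closure {x::'a. cutoff_profile n x \<noteq> 0} \<subseteq> {x. x \<bullet> x + eps n \<le> 1}"
  proof (rule closure_minimal)
    show "closed {x::'a. x \<bullet> x + eps n \<le> 1}" by (intro closed_Collect_le continuous_intros)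
  qed (use zero in force)
  also have "\<dots> \<subseteq> ball 0 1"
  proof clarify
    fix x :: 'a assume "x \<bullet> x + eps n \<le> 1"
    then have "(norm x)\<^sup>2 < 1" using eps(1)[of n] by (simp add: dot_square_norm)
    then show "x \<in> ball 0 1" by (simp add: abs_square_less_1)
  qed
  finally have sub: "closure {x::'a. cutoff_profile n x \<noteq> 0} \<subseteq> ball 0 1" .
  then have "bounded (closure {x::'a. cutoff_profile n x \<noteq> 0})" using bounded_ball bounded_subset by blast
  then show ?thesis using Ck sub by (auto simp: test_functions_def compact_eq_bounded_closed)
qed

lemma has_derivative_mult_exp_cutoff:
  assumes "0 < m"
  shows "((\<lambda>t. t * exp_cutoff 1 (m * t)) has_real_derivative exp_cutoff [:1, 1:] (m * t)) (at t)"
proof -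
  have "((\<lambda>t. exp_cutoff 1 (m * t)) has_real_derivative
      exp_cutoff ([:0,0,1:] * (1 - pderiv 1)) (m * t) * m) (at t)"
    by (rule DERIV_chain2[OF has_derivative_exp_cutoff]) (auto intro!: derivative_eq_intros)
  from DERIV_mult[OF DERIV_ident this]
  show ?thesis
  proof (rule DERIV_cong)
    show "1 * exp_cutoff 1 (m * t) + exp_cutoff ([:0,0,1:] * (1 - pderiv 1)) (m * t) * m * t =
        exp_cutoff [:1, 1:] (m * t)"
    proof (cases "m * t > 0")
      case True
      define z where "z = 1 / (m * t)"
      have "z * (m * t) = 1" using True by (auto simp: z_def)
      moreover have "exp_cutoff ([:0,0,1:] * (1 - pderiv 1)) (m * t) * m * t = z * (z * (m * t)) * exp (- z)"
        using True by (simp add: exp_cutoff_def z_def)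
      ultimately show ?thesis using True by (simp add: exp_cutoff_def z_def[symmetric] distrib_right)
    qed (simp add: exp_cutoff_def)
  qed
qed

lemma gradient_cutoff_profile:
  fixes x :: "'a::euclidean_space"
  assumes "x \<in> ball 0 1"
  shows "gradient (cutoff_profile n) x =
    exp_cutoff [:1, 1:] (real (Suc n) * profile (eps n) x) *\<^sub>R profile_grad (eps n) x"
proof (rule gradient_eqI)
  let ?\<chi> = "\<lambda>t. t * exp_cutoff 1 (real (Suc n) * t)"
  have x: "0 < x \<bullet> x + eps n" "x \<bullet> x + eps n < 2"
    using inner_self_less_1[OF assms] eps[of n] by (auto simp: add_nonneg_pos)
  have "((\<lambda>x. ?\<chi> (profile (eps n) x)) has_derivative
      (\<lambda>h. exp_cutoff [:1, 1:] (real (Suc n) * profile (eps n) x) * (profile_grad (eps n) x \<bullet> h))) (at x)"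
    by (rule has_derivative_compose[OF profile_has_derivative[OF x(1) less_imp_le[OF x(2)]]
          has_derivative_mult_exp_cutoff[unfolded has_field_derivative_def]]) simp
  then show "(cutoff_profile n has_derivative (\<lambda>h.
      (exp_cutoff [:1, 1:] (real (Suc n) * profile (eps n) x) *\<^sub>R profile_grad (eps n) x) \<bullet> h)) (at x)"
    unfolding inner_scaleR_left
  proof (rule has_derivative_transform_within_open)
    show "open {x::'a. x \<bullet> x + eps n < 2}" by (intro open_Collect_less continuous_intros)
  qed (use x in \<open>auto simp: cutoff_profile_def\<close>)
qed

lemma exp_cutoff_bounds:
  "0 \<le> exp_cutoff 1 t" "exp_cutoff 1 t \<le> 1" "0 \<le> exp_cutoff [:1, 1:] t" "exp_cutoff [:1, 1:] t \<le> 1"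
proof -
  show "0 \<le> exp_cutoff 1 t" "exp_cutoff 1 t \<le> 1" "0 \<le> exp_cutoff [:1, 1:] t"
    by (auto simp: exp_cutoff_def)
  show "exp_cutoff [:1, 1:] t \<le> 1"
  proof (cases "t > 0")
    case True
    have "(1 + 1 / t) * exp (- (1 / t)) \<le> exp (1 / t) * exp (- (1 / t))"
      by (intro mult_right_mono exp_ge_add_one_self) simp
    also have "\<dots> = 1" by (simp add: exp_add[symmetric])
    finally show ?thesis using True by (simp add: exp_cutoff_def)
  qed (simp add: exp_cutoff_def)
qed

lemma exp_cutoff_limit:
  assumes "t \<longlonglongrightarrow> l" "l > 0"
  shows "(\<lambda>n. exp_cutoff p (real (Suc n) * t n)) \<longlonglongrightarrow> poly p 0"
proof (rule Lim_transform_eventually)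
  have "(\<lambda>n. inverse (real (Suc n)) * inverse (t n)) \<longlonglongrightarrow> 0 * inverse l"
    using assms by (intro tendsto_mult LIMSEQ_inverse_real_of_nat tendsto_inverse) auto
  then have *: "(\<lambda>n. inverse (real (Suc n)) * inverse (t n)) \<longlonglongrightarrow> 0" by simp
  show "(\<lambda>n. poly p (inverse (real (Suc n)) * inverse (t n)) * exp (- (inverse (real (Suc n)) * inverse (t n)))) \<longlonglongrightarrow> poly p 0"
    using tendsto_mult[OF isCont_tendsto_compose[OF poly_isCont *] tendsto_exp[OF tendsto_minus[OF *]], of p]
    by simp
  show "\<forall>\<^sub>F n in sequentially. poly p (inverse (real (Suc n)) * inverse (t n)) *
      exp (- (inverse (real (Suc n)) * inverse (t n))) = exp_cutoff p (real (Suc n) * t n)"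
    using order_tendstoD(1)[OF assms] by eventually_elim (simp add: exp_cutoff_def inverse_eq_divide)
qed

lemma
  fixes x :: "'a::euclidean_space"
  assumes "x \<in> ball 0 1" "x \<noteq> 0"
  shows profile_grad_tendsto: "(\<lambda>n. profile_grad (eps n) x) \<longlonglongrightarrow> profile_grad 0 x"
    and profile_lap_tendsto: "(\<lambda>n. profile_lap (eps n) x) \<longlonglongrightarrow> profile_lap 0 x"
    and cutoff_profile_tendsto: "(\<lambda>n. cutoff_profile n x) \<longlonglongrightarrow> profile 0 x"
    and gradient_cutoff_profile_tendsto: "(\<lambda>n. gradient (cutoff_profile n) x) \<longlonglongrightarrow> profile_grad 0 x"
proof -
  have x: "0 < x \<bullet> x" "x \<bullet> x < 1" using inner_self_less_1[OF assms(1)] assms(2) by auto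
  then have L: "4 - ln (x \<bullet> x) \<noteq> 0" using ln_le_1[of "x \<bullet> x"] by simp
  have "(\<lambda>n. x \<bullet> x + eps n) \<longlonglongrightarrow> x \<bullet> x + 0" by (intro tendsto_intros eps_tendsto)
  then have s: "(\<lambda>n. x \<bullet> x + eps n) \<longlonglongrightarrow> x \<bullet> x" by simp
  have ln: "(\<lambda>n. ln (x \<bullet> x + eps n)) \<longlonglongrightarrow> ln (x \<bullet> x)" using x by (intro tendsto_ln s) simp
  have w: "(\<lambda>n. log_weight (x \<bullet> x + eps n)) \<longlonglongrightarrow> log_weight (x \<bullet> x)"
    unfolding log_weight_def using x L by (intro tendsto_intros s ln) auto
  have w': "(\<lambda>n. log_weight_deriv (x \<bullet> x + eps n)) \<longlonglongrightarrow> log_weight_deriv (x \<bullet> x)"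
    unfolding log_weight_deriv_def using x L by (intro tendsto_intros s ln) auto
  have p: "(\<lambda>n. profile (eps n) x) \<longlonglongrightarrow> profile 0 x"
    unfolding profile_def add_0_right using L by (intro tendsto_intros ln)
  show g: "(\<lambda>n. profile_grad (eps n) x) \<longlonglongrightarrow> profile_grad 0 x"
    unfolding profile_grad_def add_0_right by (intro tendsto_intros w)
  show "(\<lambda>n. profile_lap (eps n) x) \<longlonglongrightarrow> profile_lap 0 x"
    unfolding profile_lap_def add_0_right by (intro tendsto_intros w w')
  note lim = exp_cutoff_limit[OF p profile_pos[OF assms]]
  have "(\<lambda>n. profile (eps n) x * exp_cutoff 1 (real (Suc n) * profile (eps n) x)) \<longlonglongrightarrow> profile 0 x"
    using tendsto_mult[OF p lim[of 1]] by simp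
  moreover have "x \<bullet> x + eps n < 2" for n using x eps(2)[of n] by linarith
  ultimately show "(\<lambda>n. cutoff_profile n x) \<longlonglongrightarrow> profile 0 x" by (simp add: cutoff_profile_def)
  show "(\<lambda>n. gradient (cutoff_profile n) x) \<longlonglongrightarrow> profile_grad 0 x"
    unfolding gradient_cutoff_profile[OF assms(1)]
    using tendsto_scaleR[OF lim[of "[:1, 1:]"] g] by simp
qed

lemma cutoff_profile_bounds:
  fixes x :: "'a::euclidean_space"
  assumes "x \<in> ball 0 1"
  shows "\<bar>cutoff_profile n x\<bar> \<le> 1 / 4"
    and "(norm (gradient (cutoff_profile n) x))\<^sup>2 \<le> 4 * log_weight (x \<bullet> x)"
proof -
  have "0 < x \<bullet> x + eps n" "x \<bullet> x + eps n \<le> 2"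
    using inner_self_less_1[OF assms] eps[of n] by (auto simp: add_nonneg_pos)
  then have "\<bar>profile (eps n) x\<bar> \<le> 1 / 4" using eps[of n] by (intro profile_bounds(1)) auto
  then have "\<bar>profile (eps n) x\<bar> * exp_cutoff 1 (real (Suc n) * profile (eps n) x) \<le> 1 / 4 * 1"
    by (intro mult_mono exp_cutoff_bounds) auto
  then show "\<bar>cutoff_profile n x\<bar> \<le> 1 / 4"
    by (simp add: cutoff_profile_def abs_mult exp_cutoff_bounds)
  have "(norm (gradient (cutoff_profile n) x))\<^sup>2 \<le> (1 * norm (profile_grad (eps n) x))\<^sup>2"
    unfolding gradient_cutoff_profile[OF assms] norm_scaleR
    by (intro power_mono mult_right_mono) (auto simp: exp_cutoff_bounds)
  also have "\<dots> \<le> 4 * log_weight (x \<bullet> x)"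
    using profile_weight_bounds(1)[OF assms, of "eps n"] eps[of n] by simp
  finally show "(norm (gradient (cutoff_profile n) x))\<^sup>2 \<le> 4 * log_weight (x \<bullet> x)" .
qed

lemma profile_grad_Lp_2:
  assumes "DIM('a::euclidean_space) \<ge> 2"
  shows "profile_grad 0 \<in> Lp 2 (ball (0::'a) 1)"
proof -
  have "integrable (lebesgue_on (ball (0::'a) 1)) (\<lambda>x. (norm (profile_grad 0 x))\<^sup>2)"
  proof (rule Bochner_Integration.integrable_bound)
    show "integrable (lebesgue_on (ball (0::'a) 1)) (\<lambda>x. 4 * log_weight (x \<bullet> x))"
      using integrable_log_weight[OF assms] by simp
    show "(\<lambda>x. (norm (profile_grad 0 x))\<^sup>2) \<in> borel_measurable (lebesgue_on (ball (0::'a) 1))"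
      by (intro borel_measurable_lebesgue_onI) measurable
    show "AE x in lebesgue_on (ball (0::'a) 1). norm ((norm (profile_grad 0 x))\<^sup>2) \<le> norm (4 * log_weight (x \<bullet> x))"
      using AE_ball_nonzero
    proof eventually_elim
      fix x :: 'a assume "x \<in> ball 0 1 \<and> x \<noteq> 0"
      then show "norm ((norm (profile_grad 0 x))\<^sup>2) \<le> norm (4 * log_weight (x \<bullet> x))"
        using profile_weight_bounds(1)[of x 0] by (simp add: log_weight_nonneg)
    qed
  qed
  then show ?thesis by (simp add: Lp_2_iff borel_measurable_lebesgue_onI borel_measurable_profile)
qed

lemma solution_Lp_2: "solution \<in> Lp 2 (ball (0::'a::euclidean_space) 1)"
proof (rule Lp_2_bounded_by[where f = "\<lambda>x. 1 :: real"])
  interpret finite_measure "lebesgue_on (ball (0::'a) 1)" by (rule finite_measure_ball)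
  show "(\<lambda>x. 1 :: real) \<in> Lp 2 (ball (0::'a) 1)" by (simp add: Lp_2_iff)
  show "AE x in lebesgue_on (ball (0::'a) 1). norm (solution x) \<le> norm (1 :: real)"
    using AE_ball_nonzero by eventually_elim (use solution_bounds in force)
qed (intro borel_measurable_lebesgue_onI borel_measurable_solution)

lemma has_weak_grad_solution:
  assumes N: "DIM('a::euclidean_space) \<ge> 2"
  shows "has_weak_grad (ball (0::'a) 1) solution (profile_grad 0)"
proof (rule has_weak_grad_dominated_limit[where V = cutoff_profile and G = "\<lambda>n. gradient (cutoff_profile n)"])
  interpret finite_measure "lebesgue_on (ball (0::'a) 1)" by (rule finite_measure_ball)
  note tf = cutoff_profile_test_function[where 'a = 'a]
  show "has_weak_grad (ball (0::'a) 1) (cutoff_profile n) (gradient (cutoff_profile n))" for n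
    by (rule has_weak_grad_test_function[OF open_ball tf])
  show "cutoff_profile n \<in> borel_measurable (lebesgue_on (ball (0::'a) 1))"
    "gradient (cutoff_profile n) \<in> borel_measurable (lebesgue_on (ball (0::'a) 1))" for n
    using test_function_Lp_2[OF open_ball tf[of n]] by (auto simp: Lp_2_iff)
  show "integrable (lebesgue_on (ball (0::'a) 1)) (\<lambda>x. 1 + 4 * log_weight (x \<bullet> x))"
    using integrable_log_weight[OF N] by simp
  show "AE x in lebesgue_on (ball (0::'a) 1). (\<lambda>n. cutoff_profile n x) \<longlonglongrightarrow> solution x"
    using AE_ball_nonzero by eventually_elim (simp add: solution_def cutoff_profile_tendsto)
  show "AE x in lebesgue_on (ball (0::'a) 1). (\<lambda>n. gradient (cutoff_profile n) x) \<longlonglongrightarrow> profile_grad 0 x"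
    using AE_ball_nonzero by eventually_elim (simp add: gradient_cutoff_profile_tendsto)
  show "AE x in lebesgue_on (ball (0::'a) 1). \<bar>cutoff_profile n x\<bar> \<le> 1 + 4 * log_weight (x \<bullet> x)" for n
    using AE_ball_nonzero
  proof eventually_elim
    fix x :: 'a assume "x \<in> ball 0 1 \<and> x \<noteq> 0"
    then show "\<bar>cutoff_profile n x\<bar> \<le> 1 + 4 * log_weight (x \<bullet> x)"
      using cutoff_profile_bounds(1)[of x n] log_weight_nonneg[of "x \<bullet> x"] by simp
  qed
  show "AE x in lebesgue_on (ball (0::'a) 1). norm (gradient (cutoff_profile n) x) \<le> 1 + 4 * log_weight (x \<bullet> x)" for n
    using AE_ball_nonzero
  proof eventually_elim
    fix x :: 'a assume "x \<in> ball 0 1 \<and> x \<noteq> 0"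
    moreover have "t \<le> 1 + t\<^sup>2" if "t \<ge> 0" for t :: real
      using that sum_squares_bound[of 1 t] by simp
    ultimately show "norm (gradient (cutoff_profile n) x) \<le> 1 + 4 * log_weight (x \<bullet> x)"
      using cutoff_profile_bounds(2)[of x n] by (meson add_left_mono norm_ge_zero order_trans)
  qed
qed (simp_all add: borel_measurable_lebesgue_onI borel_measurable_profile borel_measurable_solution)

lemma solution_W12_0:
  assumes N: "DIM('a::euclidean_space) \<ge> 2"
  shows "solution \<in> W12_0 (ball (0::'a) 1)"
proof (rule W12_0I[OF open_ball solution_Lp_2 has_weak_grad_solution[OF N] profile_grad_Lp_2[OF N]])
  interpret finite_measure "lebesgue_on (ball (0::'a) 1)" by (rule finite_measure_ball)
  note tf = cutoff_profile_test_function[where 'a = 'a]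
  show "cutoff_profile k \<in> test_functions (ball (0::'a) 1)" for k by (rule tf)
  have m: "cutoff_profile n \<in> borel_measurable (lebesgue_on (ball (0::'a) 1))"
    "gradient (cutoff_profile n) \<in> borel_measurable (lebesgue_on (ball (0::'a) 1))"
    "solution \<in> borel_measurable (lebesgue_on (ball (0::'a) 1))"
    "profile_grad 0 \<in> borel_measurable (lebesgue_on (ball (0::'a) 1))" for n
    using test_function_Lp_2[OF open_ball tf[of n]]
    by (auto simp: Lp_2_iff borel_measurable_lebesgue_onI borel_measurable_profile borel_measurable_solution)
  have "(\<lambda>k. LINT x|lebesgue_on (ball (0::'a) 1). (cutoff_profile k x - solution x)\<^sup>2) \<longlonglongrightarrow>
      (LINT x|lebesgue_on (ball (0::'a) 1). 0)"
  proof (rule integral_dominated_convergence[where w = "\<lambda>x. 1"])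
    show "AE x in lebesgue_on (ball (0::'a) 1). (\<lambda>k. (cutoff_profile k x - solution x)\<^sup>2) \<longlonglongrightarrow> 0"
      using AE_ball_nonzero
    proof eventually_elim
      fix x :: 'a assume "x \<in> ball 0 1 \<and> x \<noteq> 0"
      then have "(\<lambda>k. (cutoff_profile k x - solution x)\<^sup>2) \<longlonglongrightarrow> (profile 0 x - solution x)\<^sup>2"
        by (intro tendsto_intros cutoff_profile_tendsto) auto
      then show "(\<lambda>k. (cutoff_profile k x - solution x)\<^sup>2) \<longlonglongrightarrow> 0"
        using \<open>_ \<and> x \<noteq> 0\<close> by (simp add: solution_def)
    qed
    show "AE x in lebesgue_on (ball (0::'a) 1). norm ((cutoff_profile k x - solution x)\<^sup>2) \<le> 1" for k
      using AE_ball_nonzero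
    proof eventually_elim
      fix x :: 'a assume "x \<in> ball 0 1 \<and> x \<noteq> 0"
      then have "\<bar>cutoff_profile k x - solution x\<bar> \<le> 1"
        using cutoff_profile_bounds(1)[of x k] solution_bounds[of x] by linarith
      then show "norm ((cutoff_profile k x - solution x)\<^sup>2) \<le> 1" by (simp add: abs_square_le_1)
    qed
    show "(\<lambda>x. (cutoff_profile k x - solution x)\<^sup>2) \<in> borel_measurable (lebesgue_on (ball (0::'a) 1))" for k
      by (intro borel_measurable_power borel_measurable_diff borel_measurable_norm m)
  qed simp_all
  then show "(\<lambda>k. LINT x|lebesgue_on (ball (0::'a) 1). (cutoff_profile k x - solution x)\<^sup>2) \<longlonglongrightarrow> 0" by simp
  have "(\<lambda>k. LINT x|lebesgue_on (ball (0::'a) 1). (norm (gradient (cutoff_profile k) x - profile_grad 0 x))\<^sup>2) \<longlonglongrightarrow>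
      (LINT x|lebesgue_on (ball (0::'a) 1). 0)"
  proof (rule integral_dominated_convergence[where w = "\<lambda>x. 16 * log_weight (x \<bullet> x)"])
    show "integrable (lebesgue_on (ball (0::'a) 1)) (\<lambda>x. 16 * log_weight (x \<bullet> x))"
      using integrable_log_weight[OF N] by simp
    show "AE x in lebesgue_on (ball (0::'a) 1). (\<lambda>k. (norm (gradient (cutoff_profile k) x - profile_grad 0 x))\<^sup>2) \<longlonglongrightarrow> 0"
      using AE_ball_nonzero
    proof eventually_elim
      fix x :: 'a assume "x \<in> ball 0 1 \<and> x \<noteq> 0"
      then have "(\<lambda>k. (norm (gradient (cutoff_profile k) x - profile_grad 0 x))\<^sup>2) \<longlonglongrightarrow>
          (norm (profile_grad 0 x - profile_grad 0 x))\<^sup>2"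
        by (intro tendsto_intros gradient_cutoff_profile_tendsto) auto
      then show "(\<lambda>k. (norm (gradient (cutoff_profile k) x - profile_grad 0 x))\<^sup>2) \<longlonglongrightarrow> 0" by simp
    qed
    show "AE x in lebesgue_on (ball (0::'a) 1).
        norm ((norm (gradient (cutoff_profile k) x - profile_grad 0 x))\<^sup>2) \<le> 16 * log_weight (x \<bullet> x)" for k
      using AE_ball_nonzero
    proof eventually_elim
      fix x :: 'a assume x: "x \<in> ball 0 1 \<and> x \<noteq> 0"
      let ?a = "norm (gradient (cutoff_profile k) x)" and ?b = "norm (profile_grad 0 x)"
      have "(norm (gradient (cutoff_profile k) x - profile_grad 0 x))\<^sup>2 \<le> (?a + ?b)\<^sup>2"
        by (intro power_mono norm_triangle_ineq4) simp
      also have "\<dots> \<le> 2 * (?a\<^sup>2 + ?b\<^sup>2)"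
        using sum_squares_bound[of ?a ?b] by (simp add: power2_sum)
      also have "\<dots> \<le> 16 * log_weight (x \<bullet> x)"
        using cutoff_profile_bounds(2)[of x k] profile_weight_bounds(1)[of x 0] x by simp
      finally show "norm ((norm (gradient (cutoff_profile k) x - profile_grad 0 x))\<^sup>2) \<le> 16 * log_weight (x \<bullet> x)"
        by simp
    qed
    show "(\<lambda>x. (norm (gradient (cutoff_profile k) x - profile_grad 0 x))\<^sup>2) \<in> borel_measurable (lebesgue_on (ball (0::'a) 1))" for k
      using m by measurable
  qed simp_all
  then show "(\<lambda>k. LINT x|lebesgue_on (ball (0::'a) 1). (norm (gradient (cutoff_profile k) x - profile_grad 0 x))\<^sup>2) \<longlonglongrightarrow> 0"
    by simp
qed

lemma profile_weak_laplacian: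
  fixes \<phi> :: "'a::euclidean_space \<Rightarrow> real"
  assumes N: "DIM('a) \<ge> 2" and \<phi>: "\<phi> \<in> W12_0 (ball 0 1)" "\<phi> \<in> Linf (ball 0 1)"
  shows "(LINT x|lebesgue_on (ball 0 1). profile_grad 0 x \<bullet> weak_grad (ball 0 1) \<phi> x) =
    - (LINT x|lebesgue_on (ball 0 1). profile_lap 0 x * \<phi> x)"
proof -
  let ?B = "ball (0::'a) 1"
  have \<phi>W: "\<phi> \<in> W12 ?B" using \<phi> by (simp add: W12_0_def)
  have wg: "weak_grad ?B \<phi> \<in> borel_measurable (lebesgue_on ?B)"
    "integrable (lebesgue_on ?B) (\<lambda>x. (norm (weak_grad ?B \<phi> x))\<^sup>2)"
    using W12D(2)[OF \<phi>W] by (auto simp: Lp_2_iff)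
  obtain M where M: "AE x in lebesgue_on ?B. \<bar>\<phi> x\<bar> \<le> M" and \<phi>m: "\<phi> \<in> borel_measurable (lebesgue_on ?B)"
    using \<phi>(2) by (auto simp: Linf_def)
  note m = borel_measurable_profile[THEN borel_measurable_lebesgue_onI]
  have reg: "(LINT x|lebesgue_on ?B. profile_grad (eps n) x \<bullet> weak_grad ?B \<phi> x) =
    - (LINT x|lebesgue_on ?B. profile_lap (eps n) x * \<phi> x)" for n
  proof -
    let ?X' = "\<lambda>i (x::'a) h. - 2 * (log_weight (x \<bullet> x + eps n) * (h \<bullet> i) +
      log_weight_deriv (x \<bullet> x + eps n) * (2 * (x \<bullet> h)) * (x \<bullet> i))"
    have s: "0 < x \<bullet> x + eps n" "x \<bullet> x + eps n \<le> 2" if "x \<in> ?B" for x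
      using inner_self_less_1[OF that] eps[of n] by (auto simp: add_nonneg_pos)
    have le: "log_weight (x \<bullet> x + eps n) \<le> log_weight (eps n)" if "x \<in> ?B" for x
      using s[OF that] eps(1)[of n] by (intro log_weight_antimono) auto
    have ln: "4 - ln (x \<bullet> x + eps n) \<noteq> 0" if "x \<in> ?B" for x using ln_le_1[OF s[OF that]] by simp
    have sn: "x \<bullet> x + eps n \<noteq> 0" if "x \<in> ?B" for x using s[OF that] by simp
    have "(LINT x|lebesgue_on ?B. profile_grad (eps n) x \<bullet> weak_grad ?B \<phi> x) =
      - (LINT x|lebesgue_on ?B. (\<Sum>i\<in>Basis. ?X' i x i) * \<phi> x)"
    proof (rule W12_0_integration_by_parts[OF open_ball finite_measure_ball \<phi>(1), where X' = ?X'
          and C = "1 + (2 * real DIM('a) + 4) * log_weight (eps n)"])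
      fix x i assume x: "x \<in> ?B" and i: "i \<in> (Basis :: 'a set)"
      show "((\<lambda>x. profile_grad (eps n) x \<bullet> i) has_derivative ?X' i x) (at x)"
        by (rule profile_grad_has_derivative[OF s[OF x]])
    next
      fix i assume i: "i \<in> (Basis :: 'a set)"
      show "continuous_on ?B (\<lambda>x. ?X' i x i)"
        unfolding log_weight_def log_weight_deriv_def
        by (intro continuous_intros ballI) (use ln sn in auto)
    next
      fix x assume x: "x \<in> ?B"
      have q: "0 \<le> log_weight (eps n)" using eps(1)[of n] by (simp add: log_weight_nonneg)
      have "norm (profile_grad (eps n) x) \<le> 1 + (norm (profile_grad (eps n) x))\<^sup>2"
        using sum_squares_bound[of 1 "norm (profile_grad (eps n) x)"]
          norm_ge_zero[of "profile_grad (eps n) x"] unfolding power_one mult_1_right by linarith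
      also have "\<dots> \<le> 1 + 4 * log_weight (eps n)"
        using profile_bounds(2)[OF s[OF x] less_imp_le[OF eps(1)]] le[OF x] by simp
      also have "\<dots> \<le> 1 + (2 * real DIM('a) + 4) * log_weight (eps n)"
        using q by (intro add_left_mono mult_right_mono) auto
      finally show "norm (profile_grad (eps n) x) \<le> 1 + (2 * real DIM('a) + 4) * log_weight (eps n)" .
      have "\<bar>profile_lap (eps n) x\<bar> \<le> (2 * real DIM('a) + 4) * log_weight (x \<bullet> x + eps n)"
        by (rule profile_bounds(3)[OF s[OF x] less_imp_le[OF eps(1)]])
      also have "\<dots> \<le> (2 * real DIM('a) + 4) * log_weight (eps n)"
        using le[OF x] by (intro mult_left_mono) auto
      finally show "\<bar>\<Sum>i\<in>Basis. ?X' i x i\<bar> \<le> 1 + (2 * real DIM('a) + 4) * log_weight (eps n)"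
        unfolding sum_profile_grad_derivative by simp
    qed
    then show ?thesis unfolding sum_profile_grad_derivative .
  qed
  have 1: "(\<lambda>n. LINT x|lebesgue_on ?B. profile_grad (eps n) x \<bullet> weak_grad ?B \<phi> x) \<longlonglongrightarrow>
      (LINT x|lebesgue_on ?B. profile_grad 0 x \<bullet> weak_grad ?B \<phi> x)"
  proof (rule integral_dominated_convergence[where w = "\<lambda>x. 4 * log_weight (x \<bullet> x) + (norm (weak_grad ?B \<phi> x))\<^sup>2"])
    show "integrable (lebesgue_on ?B) (\<lambda>x. 4 * log_weight (x \<bullet> x) + (norm (weak_grad ?B \<phi> x))\<^sup>2)"
      using integrable_log_weight[OF N] wg(2) by simp
    show "AE x in lebesgue_on ?B. (\<lambda>n. profile_grad (eps n) x \<bullet> weak_grad ?B \<phi> x) \<longlonglongrightarrow> profile_grad 0 x \<bullet> weak_grad ?B \<phi> x"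
      using AE_ball_nonzero by eventually_elim (intro tendsto_intros profile_grad_tendsto; simp)
    show "AE x in lebesgue_on ?B. norm (profile_grad (eps n) x \<bullet> weak_grad ?B \<phi> x) \<le>
        4 * log_weight (x \<bullet> x) + (norm (weak_grad ?B \<phi> x))\<^sup>2" for n
      using AE_ball_nonzero
    proof eventually_elim
      fix x :: 'a assume x: "x \<in> ?B \<and> x \<noteq> 0"
      let ?a = "norm (profile_grad (eps n) x)" and ?b = "norm (weak_grad ?B \<phi> x)"
      have "0 \<le> ?a * ?b" by simp
      then have "?a * ?b \<le> ?a\<^sup>2 + ?b\<^sup>2" using sum_squares_bound[of ?a ?b] by linarith
      then show "norm (profile_grad (eps n) x \<bullet> weak_grad ?B \<phi> x) \<le> 4 * log_weight (x \<bullet> x) + ?b\<^sup>2"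
        using Cauchy_Schwarz_ineq2[of "profile_grad (eps n) x" "weak_grad ?B \<phi> x"]
          profile_weight_bounds(1)[of x "eps n"] x eps[of n] by simp
    qed
  qed (use m wg in measurable)
  have 2: "(\<lambda>n. LINT x|lebesgue_on ?B. profile_lap (eps n) x * \<phi> x) \<longlonglongrightarrow>
      (LINT x|lebesgue_on ?B. profile_lap 0 x * \<phi> x)"
  proof (rule integral_dominated_convergence[where w = "\<lambda>x. (2 * real DIM('a) + 4) * log_weight (x \<bullet> x) * M"])
    show "integrable (lebesgue_on ?B) (\<lambda>x. (2 * real DIM('a) + 4) * log_weight (x \<bullet> x) * M)"
      using integrable_log_weight[OF N] by simp
    show "AE x in lebesgue_on ?B. (\<lambda>n. profile_lap (eps n) x * \<phi> x) \<longlonglongrightarrow> profile_lap 0 x * \<phi> x"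
      using AE_ball_nonzero by eventually_elim (intro tendsto_intros profile_lap_tendsto; simp)
    show "AE x in lebesgue_on ?B. norm (profile_lap (eps n) x * \<phi> x) \<le>
        (2 * real DIM('a) + 4) * log_weight (x \<bullet> x) * M" for n
      using AE_ball_nonzero M
    proof eventually_elim
      fix x :: 'a assume x: "x \<in> ?B \<and> x \<noteq> 0" "\<bar>\<phi> x\<bar> \<le> M"
      then have "\<bar>profile_lap (eps n) x\<bar> * \<bar>\<phi> x\<bar> \<le> (2 * real DIM('a) + 4) * log_weight (x \<bullet> x) * M"
        using eps[of n] by (intro mult_mono profile_weight_bounds(2)) (auto simp: log_weight_nonneg)
      then show "norm (profile_lap (eps n) x * \<phi> x) \<le> (2 * real DIM('a) + 4) * log_weight (x \<bullet> x) * M"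
        by (simp add: abs_mult)
    qed
  qed (use m \<phi>m in measurable)
  show ?thesis using LIMSEQ_unique[OF 1[unfolded reg] tendsto_minus[OF 2]] .
qed

lemma solution_is_solution:
  assumes N: "DIM('a::euclidean_space) \<ge> 2"
  shows "is_solution (ball (0::'a) 1) (\<lambda>x. - profile_lap 0 x)
    (\<lambda>x. - profile_lap 0 x * (1 + solution x)) solution"
  unfolding is_solution_def
proof (intro conjI ballI IntI)
  let ?B = "ball (0::'a) 1"
  show "solution \<in> W12_0 ?B" by (rule solution_W12_0[OF N])
  have "AE x in lebesgue_on ?B. \<bar>solution x\<bar> \<le> 1 / 4"
    using AE_ball_nonzero by eventually_elim (use solution_bounds in force)
  then show "solution \<in> Linf ?B"
    unfolding Linf_def using borel_measurable_lebesgue_onI[OF borel_measurable_solution] by blast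
  fix \<phi> :: "'a \<Rightarrow> real" assume \<phi>: "\<phi> \<in> W12_0 ?B \<inter> Linf ?B"
  then have \<phi>W: "\<phi> \<in> W12 ?B" by (simp add: W12_0_def)
  obtain M where M: "AE x in lebesgue_on ?B. \<bar>\<phi> x\<bar> \<le> M" and \<phi>m: "\<phi> \<in> borel_measurable (lebesgue_on ?B)"
    using \<phi> by (auto simp: Linf_def)
  have wg: "weak_grad ?B \<phi> \<in> borel_measurable (lebesgue_on ?B)"
    using W12D(2)[OF \<phi>W] by (simp add: Lp_2_iff)
  note m = borel_measurable_profile[THEN borel_measurable_lebesgue_onI]
    borel_measurable_solution[THEN borel_measurable_lebesgue_onI]
  have "(LINT x|lebesgue_on ?B. weak_grad ?B solution x \<bullet> weak_grad ?B \<phi> x) =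
      (LINT x|lebesgue_on ?B. profile_grad 0 x \<bullet> weak_grad ?B \<phi> x)"
  proof (rule integral_cong_AE)
    show "AE x in lebesgue_on ?B. weak_grad ?B solution x \<bullet> weak_grad ?B \<phi> x = profile_grad 0 x \<bullet> weak_grad ?B \<phi> x"
      using weak_grad_AE_eq[OF open_ball has_weak_grad_solution[OF N]] by eventually_elim simp
    show "(\<lambda>x. weak_grad ?B solution x \<bullet> weak_grad ?B \<phi> x) \<in> borel_measurable (lebesgue_on ?B)"
      using weak_grad_measurable[OF open_ball has_weak_grad_solution[OF N] m(4)] wg by measurable
  qed (use m wg in measurable)
  also have "\<dots> = - (LINT x|lebesgue_on ?B. profile_lap 0 x * \<phi> x)"
    using \<phi> by (intro profile_weak_laplacian[OF N]) auto
  finally have 1: "(LINT x|lebesgue_on ?B. weak_grad ?B solution x \<bullet> weak_grad ?B \<phi> x) =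
      - (LINT x|lebesgue_on ?B. profile_lap 0 x * \<phi> x)" .
  have i1: "integrable (lebesgue_on ?B) (\<lambda>x. profile_lap 0 x * \<phi> x)"
  proof (rule Bochner_Integration.integrable_bound)
    show "integrable (lebesgue_on ?B) (\<lambda>x. (2 * real DIM('a) + 4) * log_weight (x \<bullet> x) * M)"
      using integrable_log_weight[OF N] by simp
    show "AE x in lebesgue_on ?B. norm (profile_lap 0 x * \<phi> x) \<le>
        norm ((2 * real DIM('a) + 4) * log_weight (x \<bullet> x) * M)"
      using AE_ball_nonzero M
    proof eventually_elim
      fix x :: 'a assume x: "x \<in> ?B \<and> x \<noteq> 0" "\<bar>\<phi> x\<bar> \<le> M"
      then have "\<bar>profile_lap 0 x\<bar> * \<bar>\<phi> x\<bar> \<le> (2 * real DIM('a) + 4) * log_weight (x \<bullet> x) * M"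
        by (intro mult_mono profile_weight_bounds(2)) (auto simp: log_weight_nonneg)
      then show "norm (profile_lap 0 x * \<phi> x) \<le> norm ((2 * real DIM('a) + 4) * log_weight (x \<bullet> x) * M)"
        unfolding real_norm_def abs_mult[of "profile_lap 0 x"] by (rule order_trans[OF _ abs_ge_self])
    qed
  qed (use m \<phi>m in measurable)
  have i2: "integrable (lebesgue_on ?B) (\<lambda>x. profile_lap 0 x * solution x * \<phi> x)"
  proof (rule Bochner_Integration.integrable_bound[OF i1])
    show "AE x in lebesgue_on ?B. norm (profile_lap 0 x * solution x * \<phi> x) \<le> norm (profile_lap 0 x * \<phi> x)"
      using AE_ball_nonzero
    proof eventually_elim
      fix x :: 'a assume x: "x \<in> ?B \<and> x \<noteq> 0"
      then have "\<bar>solution x\<bar> \<le> 1" using solution_bounds[of x] by auto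
      then have "\<bar>profile_lap 0 x * \<phi> x\<bar> * \<bar>solution x\<bar> \<le> \<bar>profile_lap 0 x * \<phi> x\<bar> * 1"
        by (intro mult_left_mono) auto
      then show "norm (profile_lap 0 x * solution x * \<phi> x) \<le> norm (profile_lap 0 x * \<phi> x)"
        by (simp add: abs_mult mult_ac)
    qed
  qed (use m \<phi>m in measurable)
  have "(LINT x|lebesgue_on ?B. - profile_lap 0 x * (1 + solution x) * \<phi> x) =
      (LINT x|lebesgue_on ?B. - (profile_lap 0 x * \<phi> x) - profile_lap 0 x * solution x * \<phi> x)"
    by (simp add: algebra_simps)
  also have "\<dots> = - (LINT x|lebesgue_on ?B. profile_lap 0 x * \<phi> x) -
      (LINT x|lebesgue_on ?B. profile_lap 0 x * solution x * \<phi> x)"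
    using i1 i2 by simp
  finally show "(LINT x|lebesgue_on ?B. weak_grad ?B solution x \<bullet> weak_grad ?B \<phi> x) +
      (LINT x|lebesgue_on ?B. - profile_lap 0 x * solution x * \<phi> x) =
      (LINT x|lebesgue_on ?B. - profile_lap 0 x * (1 + solution x) * \<phi> x)"
    unfolding 1 by simp
qed

theorem proposition3p1:
  fixes \<Omega> :: "(real ^ 'n) set"
  assumes "CARD('n) \<ge> 2"
    and "\<Omega> = ball 0 1"
  shows "\<exists>a\<in>Lp (real CARD('n) / 2) \<Omega>. \<exists>f\<in>Lp (real CARD('n) / 2) \<Omega>.
           (\<forall>x\<in>\<Omega>. 0 \<le> a x) \<and> (\<forall>x\<in>\<Omega>. 0 \<le> f x) \<and>
           (\<exists>Q>0. AE x in lebesgue_on \<Omega>. \<bar>f x\<bar> \<le> Q * a x) \<and>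
           (\<exists>u. is_solution \<Omega> a f u \<and> continuous_on \<Omega> u \<and>
                (\<forall>\<gamma>\<in>{0<..1}. \<not> holder_continuous_on \<gamma> \<Omega> u))"
proof -
  define a :: "real ^ 'n \<Rightarrow> real" where "a = (\<lambda>x. - profile_lap 0 x)"
  define f :: "real ^ 'n \<Rightarrow> real" where "f = (\<lambda>x. - profile_lap 0 x * (1 + solution x))"
  have N: "DIM(real ^ 'n) \<ge> 2" using assms(1) by simp
  have a0: "0 \<le> a x" if "x \<in> \<Omega>" for x
    using profile_lap_nonpos[OF _ N] that assms(2) by (simp add: a_def)
  have fa: "0 \<le> f x" "f x \<le> 2 * a x" if "x \<in> \<Omega>" for x
    using a0[OF that] solution_bounds[of x] that assms(2)
      mult_left_mono[of "1 + solution x" 2 "a x"]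
    by (simp_all add: f_def a_def mult_nonpos_nonneg mult.commute)
  have z: "profile_lap 0 (0 :: real ^ 'n) = 0" by (simp add: profile_lap_def log_weight_def)
  have ale: "\<bar>a x\<bar> \<le> (2 * real DIM(real ^ 'n) + 4) * log_weight (x \<bullet> x)" if "x \<in> ball 0 1" "x \<noteq> 0" for x
    using profile_weight_bounds(2)[of x 0] that by (simp add: a_def)
  have aL: "a \<in> Lp (real DIM(real ^ 'n) / 2) \<Omega>"
    unfolding assms(2)
  proof (rule Lp_bounded_by_log_weight[OF N _ ale])
    show "a \<in> borel_measurable borel" unfolding a_def by measurable
  qed (simp_all add: a_def z)
  have fL: "f \<in> Lp (real DIM(real ^ 'n) / 2) \<Omega>"
    unfolding assms(2)
  proof (rule Lp_bounded_by_log_weight[OF N])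
    show "f \<in> borel_measurable borel" unfolding f_def by measurable
    fix x :: "real ^ 'n" assume x: "x \<in> ball 0 1" "x \<noteq> 0"
    then have "\<bar>f x\<bar> \<le> 2 * \<bar>a x\<bar>" using fa[of x] assms(2) by simp
    then show "\<bar>f x\<bar> \<le> (2 * (2 * real DIM(real ^ 'n) + 4)) * log_weight (x \<bullet> x)"
      using ale[OF x] by linarith
  qed (simp_all add: f_def z)
  show ?thesis
  proof (rule bexI[of _ a], rule bexI[of _ f], intro conjI)
    show "a \<in> Lp (real CARD('n) / 2) \<Omega>" "f \<in> Lp (real CARD('n) / 2) \<Omega>"
      using aL fL by simp_all
    show "\<exists>Q>0. AE x in lebesgue_on \<Omega>. \<bar>f x\<bar> \<le> Q * a x"
      by (intro exI[of _ 2] conjI AE_I2) (use fa in auto)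
    have "is_solution \<Omega> a f solution"
      unfolding assms(2) a_def f_def by (rule solution_is_solution[OF N])
    moreover have "continuous_on \<Omega> solution" unfolding assms(2) by (rule continuous_on_solution)
    moreover have "\<forall>\<gamma>\<in>{0<..1}. \<not> holder_continuous_on \<gamma> \<Omega> solution"
      unfolding assms(2) by (intro ballI solution_not_holder) simp
    ultimately show "\<exists>u. is_solution \<Omega> a f u \<and> continuous_on \<Omega> u \<and>
        (\<forall>\<gamma>\<in>{0<..1}. \<not> holder_continuous_on \<gamma> \<Omega> u)" by blast
  qed (simp_all add: a0 fa(1))
qed

end
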